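(* Let $(X_k)_{k\ge1}$ be a sequence of i.i.d. random variables having uniform distribution on $[0,1]$, and let $$P_N=\prod_{k=1}^N2\sin(\pi X_k).$$ Then for all $\varepsilon>0$ we have, almost surely, $$P_N\le\exp\left(\left(\frac{\pi}{\sqrt6}+\varepsilon\right)\sqrt{N\log\log N}\right)$$ for all sufficiently large $N$, and $$P_N\ge\exp\left(\left(\frac{\pi}{\sqrt6}-\varepsilon\right)\sqrt{N\log\log N}\right)$$ for infinitely many $N$. *)

theory Defs
  imports "HOL-Probability.Probability"
begin

definition sine_prod :: "(nat \<Rightarrow> 'a \<Rightarrow> real) \<Rightarrow> nat \<Rightarrow> 'a \<Rightarrow> real" where
  "sine_prod X N \<omega> = (\<Prod>k=1..N. 2 * sin (pi * X k \<omega>))"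

end

(*
The logarithm of the product is a sum of i.i.d. variables Y = ln (2 sin (pi X)). A Beta integral gives
E exp (t Y) = Gamma (1 + t) / Gamma (1 + t / 2)^2 = 1 + pi^2 t^2 / 24 + o(t^2), so Y has mean 0, variance
pi^2 / 12 and exponential moments, and the claim is the law of the iterated logarithm for Y.
Upper half: a first-passage argument bounds the probability that the partial sums up to n exceed l by
exp (- t l) (E exp (t Y))^n; apply it along a geometric sequence and use Borel-Cantelli.
Lower half: on very long disjoint blocks, split into about log k equal sub-blocks, ask for a fixed large
deviation on each sub-block. The central limit theorem bounds the probability of this from below by 1 / k,
so the second Borel-Cantelli lemma applies; Chebyshev's inequality controls the sum before the block.
*)
theory Submission
  imports Defs
begin

section \<open>Moments of the logarithm of the sine\<close>

text \<open>The Beta integral does all the analysis of the logarithm: no log-sine integral is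
  evaluated, because the missing linear term in the expansion already forces the mean to be 0. The
  constant of the theorem is sqrt (2 * pi^2 / 12) = pi / sqrt 6. The obstacle in the lower half is
  that deviations of about sqrt (2 ln ln n) standard deviations are out of reach of the central
  limit theorem, which treats a fixed level a only. Sub-blocks remove it. Take about 2 ln k / (D
  a^2) of them, each deviating with probability at least exp (- D a^2 / 2): the joint event has
  probability at least 1 / k, and it lifts the block sum by a times the square root of the number of
  sub-blocks, that is by about sqrt (2 ln k / D) standard deviations of the block. Any D > 1 is
  allowed once a is large, since the Gaussian tail has leading exponent a^2 / 2. With block ends of
  factorial size, ln (ln n) is asymptotic to ln k, so this is the correct normalisation.\<close>

lemma Polygamma_1_1_real: "Polygamma 1 (1::real) = pi\<^sup>2 / 6"
proof -
  have "(\<lambda>k. inverse ((1 + real k) ^ 2)) sums (pi\<^sup>2 / 6)"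
    using inverse_squares_sums by (simp add: field_simps)
  then show ?thesis
    by (simp add: Polygamma_def sums_iff eval_nat_numeral)
qed

text \<open>The two digamma terms cancel at 0, so the logarithm \<open>F\<close> of the ratio has no
  linear term; its second derivative there is half of \<open>Polygamma 1 1\<close>, that is pi^2 /
  12. One application of l'Hospital then halves this.\<close>

lemma Gamma_ratio_second_order:
  "((\<lambda>t::real. (Gamma (1 + t) / (Gamma (1 + t / 2))\<^sup>2 - 1) / t\<^sup>2) \<longlongrightarrow> pi\<^sup>2 / 24) (at_right 0)"
proof -
  define F where "F = (\<lambda>t::real. ln_Gamma (1 + t) - 2 * ln_Gamma (1 + t / 2))"
  define F' where "F' = (\<lambda>t::real. Digamma (1 + t) - Digamma (1 + t / 2))"
  have F: "(F has_real_derivative F' t) (at t)" if "t > -1" for t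
    unfolding F_def F'_def using that by (auto intro!: derivative_eq_intros)
  have "(F' has_real_derivative Polygamma 1 (1 + 0) - Polygamma 1 (1 + 0) / 2) (at 0)"
    unfolding F'_def by (auto intro!: derivative_eq_intros)
  moreover have "Polygamma 1 (1 + 0) - Polygamma 1 (1 + 0) / 2 = pi\<^sup>2 / 12"
    unfolding add_0_right Polygamma_1_1_real by simp
  ultimately have "((\<lambda>t. F' t / t) \<longlongrightarrow> pi\<^sup>2 / 12) (at 0)"
    by (simp only: has_field_derivative_iff) (simp add: F'_def)
  then have F'_lim: "((\<lambda>t. F' t / t) \<longlongrightarrow> pi\<^sup>2 / 12) (at_right 0)"
    by (rule filterlim_at_split[THEN iffD1, THEN conjunct2])
  have F0: "F 0 = 0" by (simp add: F_def ln_Gamma_real_pos)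
  have expF_lim: "((\<lambda>t. exp (F t)) \<longlongrightarrow> 1) (at_right 0)"
  proof -
    have "isCont (\<lambda>t. exp (F t)) 0"
      using DERIV_isCont[OF F[of 0]] by (intro continuous_intros) auto
    then show ?thesis using F0 by (auto simp: isCont_def filterlim_at_split)
  qed
  have "((\<lambda>t. (exp (F t) - 1) / t\<^sup>2) \<longlongrightarrow> pi\<^sup>2 / 24) (at_right 0)"
  proof (rule lhopital_right_0[where f' = "\<lambda>t. exp (F t) * F' t" and g' = "\<lambda>t. 2 * t"])
    show "((\<lambda>t. exp (F t) - 1) \<longlongrightarrow> 0) (at_right 0)"
      using tendsto_diff[OF expF_lim tendsto_const[of 1]] by simp
    show "((\<lambda>t::real. t\<^sup>2) \<longlongrightarrow> 0) (at_right 0)"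
      by (auto intro!: tendsto_eq_intros)
    have "((\<lambda>t. exp (F t) * (F' t / t) / 2) \<longlongrightarrow> 1 * (pi\<^sup>2 / 12) / 2) (at_right 0)"
      by (intro tendsto_intros expF_lim F'_lim) auto
    then show "((\<lambda>t. exp (F t) * F' t / (2 * t)) \<longlongrightarrow> pi\<^sup>2 / 24) (at_right 0)"
      by (simp add: field_simps)
    show "\<forall>\<^sub>F t in at_right 0. ((\<lambda>t. exp (F t) - 1) has_real_derivative exp (F t) * F' t) (at t)"
      by (rule eventually_at_right_less[THEN eventually_mono])
        (auto intro!: derivative_eq_intros F)
    show "\<forall>\<^sub>F t::real in at_right 0. ((\<lambda>t. t\<^sup>2) has_real_derivative 2 * t) (at t)"
      by (intro always_eventually allI) (auto intro!: derivative_eq_intros)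
  qed (auto simp: eventually_at_filter)
  moreover have "exp (F t) = Gamma (1 + t) / (Gamma (1 + t / 2))\<^sup>2" if "t > 0" for t
    using that by (simp add: F_def exp_diff Gamma_real_pos_exp exp_double)
  ultimately show ?thesis
    by (smt (verit) eventually_at_right_less Lim_transform_eventually eventually_mono)
qed

text \<open>The substitution \<open>u = sin\<^sup>2 (\<pi> x / 2)\<close> turns this into a Beta integral, which Legendre's duplication
  formula simplifies.\<close>

lemma nn_integral_sine_powr:
  fixes t :: real
  assumes t: "t > -1"
  shows "(\<integral>\<^sup>+x\<in>{0..1}. ennreal ((2 * sin (pi * x)) powr t) \<partial>lborel)
    = ennreal (Gamma (1 + t) / (Gamma (1 + t / 2))\<^sup>2)"
proof -
  let ?b = "(t + 1) / 2"
  define f where "f = (\<lambda>u::real. u powr (?b - 1) * (1 - u) powr (?b - 1))"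
  define g where "g = (\<lambda>x::real. (sin (pi * x / 2))\<^sup>2)"
  define g' where "g' = (\<lambda>x::real. pi * (sin (pi * x / 2) * cos (pi * x / 2)))"
  have b: "?b > 0" using t by simp
  have "ennreal (Beta ?b ?b) = (\<integral>\<^sup>+u. ennreal (f u) * indicator {0..1} u \<partial>lborel)"
    by (rule nn_integral_has_integral_lebesgue'[symmetric])
      (use has_integral_Beta_real[OF b b] in \<open>auto simp: f_def\<close>)
  also have "\<dots> = (\<integral>\<^sup>+u. ennreal (f u * indicator {g 0..g 1} u) \<partial>lborel)"
    by (intro nn_integral_cong) (auto simp: g_def split: split_indicator)
  also have "\<dots> = (\<integral>\<^sup>+x. ennreal (f (g x) * g' x * indicator {0..1} x) \<partial>lborel)"
  proof (rule nn_integral_substitution)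
    show "set_borel_measurable borel {g 0..g 1} f"
      unfolding f_def set_borel_measurable_def by measurable
    show "(g has_real_derivative g' x) (at x)" for x
      unfolding g_def g'_def by (auto intro!: derivative_eq_intros)
    show "continuous_on {0..1} g'" unfolding g'_def by (auto intro!: continuous_intros)
    show "0 \<le> g' x" if "x \<in> {0..1}" for x
    proof -
      have "0 \<le> pi * x / 2" "pi * x / 2 \<le> pi / 2" using that by auto
      then have "0 \<le> sin (pi * x / 2)" "0 \<le> cos (pi * x / 2)"
        using pi_gt_zero by (intro sin_ge_zero cos_ge_zero; linarith)+
      then show ?thesis unfolding g'_def by simp
    qed
  qed simp
  also have "\<dots> = (\<integral>\<^sup>+x. ennreal (pi * 4 powr (-t)) *
      (ennreal ((2 * sin (pi * x)) powr t) * indicator {0..1} x) \<partial>lborel)"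
  proof (intro nn_integral_cong)
    fix x :: real
    \<comment> \<open>At both endpoints the two sides are 0: the Jacobian \<open>g'\<close> vanishes
      there, and \<open>0 powr t = 0\<close> for every \<open>t\<close>, including
      \<open>t \<le> 0\<close>.\<close>
    consider "x \<notin> {0..1}" | "x = 0" | "x = 1" | "0 < x" "x < 1" by fastforce
    then show "ennreal (f (g x) * g' x * indicator {0..1} x) =
      ennreal (pi * 4 powr (-t)) * (ennreal ((2 * sin (pi * x)) powr t) * indicator {0..1} x)"
    proof cases
      case 4
      define u where "u = sin (pi * x / 2)"
      define v where "v = cos (pi * x / 2)"
      have pos: "u > 0" "v > 0"
        using 4 unfolding u_def v_def by (auto intro!: sin_gt_zero cos_gt_zero)
      have "1 - u\<^sup>2 = v\<^sup>2" unfolding u_def v_def by (simp add: cos_squared_eq)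
      then have "f (g x) = (u\<^sup>2) powr (?b - 1) * (v\<^sup>2) powr (?b - 1)"
        by (simp add: f_def g_def u_def)
      also have "\<dots> = (u * v) powr (t - 1)"
      proof -
        have "(w\<^sup>2) powr (?b - 1) = w powr (2 * (?b - 1))" if "w > 0" for w :: real
          using that by (simp only: powr_powr[symmetric] powr_numeral)
        moreover have "2 * (?b - 1) = t - 1" by (simp add: field_simps)
        ultimately have "(w\<^sup>2) powr (?b - 1) = w powr (t - 1)" if "w > 0" for w :: real
          using that by (simp only:)
        then show ?thesis using pos by (simp only: powr_mult)
      qed
      finally have "f (g x) * g' x = pi * ((u * v) powr (t - 1) * (u * v) powr 1)"
        using pos by (simp add: g'_def u_def v_def)
      also have "\<dots> = pi * (u * v) powr t"
        unfolding powr_add[symmetric] by simp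
      also have "u * v = sin (pi * x) / 2"
        using sin_double[of "pi * x / 2"] by (simp add: u_def v_def)
      also have "(sin (pi * x) / 2) powr t = 4 powr (-t) * (2 * sin (pi * x)) powr t"
      proof -
        have "sin (pi * x) > 0" using 4 by (intro sin_gt_zero) auto
        then have "(2 * sin (pi * x)) powr t = (4 * (sin (pi * x) / 2)) powr t" by simp
        also have "\<dots> = 4 powr t * (sin (pi * x) / 2) powr t"
          using \<open>sin (pi * x) > 0\<close> by (subst powr_mult) auto
        finally show ?thesis by (simp add: powr_minus field_simps)
      qed
      finally show ?thesis
        using 4 by (simp add: ennreal_mult' mult.assoc)
    qed (auto simp: g'_def)
  qed
  also have "\<dots> = ennreal (pi * 4 powr (-t)) *
      (\<integral>\<^sup>+x\<in>{0..1}. ennreal ((2 * sin (pi * x)) powr t) \<partial>lborel)"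
    by (rule nn_integral_cmult) measurable
  finally have *: "ennreal (pi * 4 powr (-t)) *
      (\<integral>\<^sup>+x\<in>{0..1}. ennreal ((2 * sin (pi * x)) powr t) \<partial>lborel) = ennreal (Beta ?b ?b)" ..
  \<comment> \<open>Legendre's formula at \<open>?b\<close>: shifting by 1/2 gives
    \<open>1 + t / 2\<close> and doubling gives \<open>1 + t\<close>. It is applied over the complex
    numbers and brought back by injectivity of \<open>of_real\<close>.\<close>
  have dup: "Gamma ?b * Gamma (1 + t / 2) = 2 powr (-t) * sqrt pi * Gamma (1 + t)"
  proof -
    have "complex_of_real (Gamma ?b * Gamma (1 + t / 2))
        = complex_of_real (exp ((1 - 2 * ?b) * ln 2) * sqrt pi * Gamma (2 * ?b))"
    proof -
      have 1: "complex_of_real ?b \<notin> \<int>\<^sub>\<le>\<^sub>0" "complex_of_real ?b + 1 / 2 \<notin> \<int>\<^sub>\<le>\<^sub>0"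
      proof -
        have pos: "complex_of_real x \<notin> \<int>\<^sub>\<le>\<^sub>0" if "x > 0" for x
          using that nonpos_Ints_nonpos[of x] by (auto simp: of_real_in_nonpos_Ints_iff)
        show "complex_of_real ?b \<notin> \<int>\<^sub>\<le>\<^sub>0" by (rule pos[OF b])
        have "complex_of_real (?b + 1 / 2) \<notin> \<int>\<^sub>\<le>\<^sub>0" using b by (intro pos) linarith
        then show "complex_of_real ?b + 1 / 2 \<notin> \<int>\<^sub>\<le>\<^sub>0" by simp
      qed
      have 2: "complex_of_real ?b + 1 / 2 = complex_of_real (1 + t / 2)"
        by (simp add: field_simps)
      have 3: "2 * complex_of_real ?b = complex_of_real (2 * ?b)" by simp
      have 4: "exp ((1 - complex_of_real (2 * ?b)) * of_real (ln 2)) =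
          complex_of_real (exp ((1 - 2 * ?b) * ln 2))"
        by (simp only: exp_of_real[symmetric] of_real_mult of_real_diff of_real_1)
      show ?thesis
        using Gamma_legendre_duplication[OF 1] unfolding 2 3 4 Gamma_complex_of_real
        by (simp only: of_real_mult)
    qed
    then have "Gamma ?b * Gamma (1 + t / 2) = exp ((1 - 2 * ?b) * ln 2) * sqrt pi * Gamma (2 * ?b)"
      by (simp only: of_real_eq_iff)
    moreover have e: "2 * ?b = 1 + t" by (simp add: field_simps)
    ultimately show ?thesis unfolding e by (simp add: powr_def)
  qed
  have "Gamma (1 + t / 2) > 0" "Gamma (1 + t) > 0" using t by auto
  then have "Gamma ?b = 2 powr (-t) * sqrt pi * Gamma (1 + t) / Gamma (1 + t / 2)"
    using dup by (simp add: field_simps)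
  moreover have "Beta ?b ?b = Gamma ?b * Gamma ?b / Gamma (1 + t)"
    unfolding Beta_def by (rule arg_cong[where f = "\<lambda>x. _ / Gamma x"]) (simp add: field_simps)
  ultimately have "Beta ?b ?b = (2 powr (-t))\<^sup>2 * pi * (Gamma (1 + t))\<^sup>2 / (Gamma (1 + t / 2))\<^sup>2 / Gamma (1 + t)"
    by (simp add: power_divide power_mult_distrib flip: power2_eq_square)
  also have "(2 powr (-t))\<^sup>2 = 4 powr (-t)"
    by (simp add: power2_eq_square flip: powr_mult)
  finally have "Beta ?b ?b = pi * 4 powr (-t) * (Gamma (1 + t) / (Gamma (1 + t / 2))\<^sup>2)"
    using \<open>Gamma (1 + t) > 0\<close> by (simp add: power2_eq_square)
  with * have "ennreal (pi * 4 powr (-t)) *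
      (\<integral>\<^sup>+x\<in>{0..1}. ennreal ((2 * sin (pi * x)) powr t) \<partial>lborel) =
      ennreal (pi * 4 powr (-t)) * ennreal (Gamma (1 + t) / (Gamma (1 + t / 2))\<^sup>2)"
    by (simp only: ennreal_mult' pi_ge_zero powr_ge_zero mult_nonneg_nonneg)
  then show ?thesis by (subst (asm) ennreal_mult_cancel_left) auto
qed

section \<open>Second-order expansion of a moment generating function at 0\<close>

lemma exp_minus_linear_bound: "\<bar>exp x - 1 - x\<bar> \<le> x\<^sup>2 / 2 * exp \<bar>x\<bar>" for x :: real
proof -
  obtain u where u: "\<bar>u\<bar> \<le> \<bar>x\<bar>" "exp x = (\<Sum>m<2. x ^ m / fact m) + exp u / fact 2 * x ^ 2"
    using Maclaurin_exp_le[of x 2] by blast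
  have "exp x - 1 - x = x\<^sup>2 / 2 * exp u"
    using u(2) by (simp add: eval_nat_numeral field_simps)
  moreover have "x\<^sup>2 / 2 * exp u \<le> x\<^sup>2 / 2 * exp \<bar>x\<bar>"
    using u(1) by (intro mult_left_mono) auto
  moreover have "x\<^sup>2 / 2 * exp u \<ge> 0" by simp
  ultimately show ?thesis by linarith
qed

lemma square_le_exp: "x\<^sup>2 \<le> 2 * exp \<bar>x\<bar>" for x :: real
proof -
  have "1 + \<bar>x\<bar> + \<bar>x\<bar>\<^sup>2 / 2 \<le> exp \<bar>x\<bar>"
    by (rule exp_lower_Taylor_quadratic) simp
  then show ?thesis by simp
qed

context prob_space begin

context
  fixes Y :: "'a \<Rightarrow> real" and h :: real
  assumes Y [measurable]: "Y \<in> borel_measurable M"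
    and h: "h > 0" and int: "integrable M (\<lambda>\<omega>. exp (h * \<bar>Y \<omega>\<bar>))"
begin

lemma integrable_square_of_exp: "integrable M (\<lambda>\<omega>. (Y \<omega>)\<^sup>2)"
proof (rule Bochner_Integration.integrable_bound)
  show "integrable M (\<lambda>\<omega>. 2 / h\<^sup>2 * exp (h * \<bar>Y \<omega>\<bar>))"
    using int by simp
  show "AE \<omega> in M. norm ((Y \<omega>)\<^sup>2) \<le> norm (2 / h\<^sup>2 * exp (h * \<bar>Y \<omega>\<bar>))"
  proof (intro AE_I2)
    fix \<omega>
    show "norm ((Y \<omega>)\<^sup>2) \<le> norm (2 / h\<^sup>2 * exp (h * \<bar>Y \<omega>\<bar>))"
      using square_le_exp[of "h * Y \<omega>"] h by (simp add: field_simps abs_mult power_mult_distrib)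
  qed
qed measurable

lemma integrable_of_exp: "integrable M Y"
  by (rule square_integrable_imp_integrable[OF _ integrable_square_of_exp]) measurable

lemma integrable_exp_mult:
  assumes "\<bar>t\<bar> \<le> h" shows "integrable M (\<lambda>\<omega>. exp (t * Y \<omega>))"
proof (rule Bochner_Integration.integrable_bound[OF int])
  have "t * Y \<omega> \<le> h * \<bar>Y \<omega>\<bar>" for \<omega>
    using assms abs_ge_self[of "t * Y \<omega>"] mult_right_mono[OF assms, of "\<bar>Y \<omega>\<bar>"]
    by (simp add: abs_mult)
  then show "AE \<omega> in M. norm (exp (t * Y \<omega>)) \<le> norm (exp (h * \<bar>Y \<omega>\<bar>))"
    by simp
qed measurable

text \<open>Dominated convergence along an arbitrary sequence tending to 0; the integrand converges
  pointwise to half the square, and the bounds above supply the dominating function.\<close>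

lemma mgf_second_order:
  "((\<lambda>t. (expectation (\<lambda>\<omega>. exp (t * Y \<omega>)) - 1 - t * expectation Y) / t\<^sup>2)
     \<longlongrightarrow> expectation (\<lambda>\<omega>. (Y \<omega>)\<^sup>2) / 2) (at 0)"
  unfolding tendsto_at_iff_sequentially
proof (intro allI impI)
  fix t :: "nat \<Rightarrow> real"
  assume t0: "\<forall>i. t i \<in> UNIV - {0}" and tlim: "t \<longlonglongrightarrow> 0"
  define g where "g = (\<lambda>i \<omega>. (exp (t i * Y \<omega>) - 1 - t i * Y \<omega>) / (t i)\<^sup>2)"
  \<comment> \<open>One half of the exponential moment absorbs the factor
    \<open>(Y \<omega>)\<^sup>2\<close>, the other half the exponential in the Taylor
    remainder.\<close>
  define b where "b = h / 2"
  have b: "b > 0" using h by (simp add: b_def)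
  obtain N where N: "\<And>i. i \<ge> N \<Longrightarrow> \<bar>t i\<bar> \<le> b"
    using LIMSEQ_D[OF tlim b] by (auto intro: less_imp_le)
  have [measurable]: "g i \<in> borel_measurable M" for i
    unfolding g_def by measurable
  have lim: "(\<lambda>i. expectation (g (i + N))) \<longlonglongrightarrow> expectation (\<lambda>\<omega>. (Y \<omega>)\<^sup>2 / 2)"
  proof (rule integral_dominated_convergence)
    show "integrable M (\<lambda>\<omega>. 1 / b\<^sup>2 * exp (h * \<bar>Y \<omega>\<bar>))" using int by simp
    show "AE \<omega> in M. (\<lambda>i. g (i + N) \<omega>) \<longlonglongrightarrow> (Y \<omega>)\<^sup>2 / 2"
    proof (intro AE_I2)
      fix \<omega>
      have "((\<lambda>x. (exp (x * y) - 1 - x * y) / x\<^sup>2) \<longlongrightarrow> y\<^sup>2 / 2) (at 0)" for y :: real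
      proof (rule lhopital[where f' = "\<lambda>x. y * exp (x * y) - y" and g' = "\<lambda>x. 2 * x"])
        have "((\<lambda>x. exp (x * y)) has_real_derivative y) (at 0)"
          by (auto intro!: derivative_eq_intros)
        then have "((\<lambda>x. (exp (x * y) - 1) / x) \<longlongrightarrow> y) (at 0)"
          by (simp add: has_field_derivative_iff)
        then have "((\<lambda>x. y / 2 * ((exp (x * y) - 1) / x)) \<longlongrightarrow> y / 2 * y) (at 0)"
          by (intro tendsto_intros)
        then show "((\<lambda>x. (y * exp (x * y) - y) / (2 * x)) \<longlongrightarrow> y\<^sup>2 / 2) (at 0)"
          by (rule filterlim_cong[THEN iffD1, rotated -1])
            (simp_all add: power2_eq_square field_simps eventually_at_filter)
        show "\<forall>\<^sub>F x in at 0. ((\<lambda>x. exp (x * y) - 1 - x * y) has_real_derivative y * exp (x * y) - y) (at x)"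
          "\<forall>\<^sub>F x::real in at 0. ((\<lambda>x. x\<^sup>2) has_real_derivative 2 * x) (at x)"
          by (intro always_eventually allI; auto intro!: derivative_eq_intros)+
      qed (auto intro!: tendsto_eq_intros simp: eventually_at_filter)
      then have "((\<lambda>x. (exp (x * y) - 1 - x * y) / x\<^sup>2) \<circ> t) \<longlonglongrightarrow> y\<^sup>2 / 2" for y :: real
        using t0 tlim unfolding tendsto_at_iff_sequentially by blast
      from LIMSEQ_ignore_initial_segment[OF this, where k = N]
      show "(\<lambda>i. g (i + N) \<omega>) \<longlonglongrightarrow> (Y \<omega>)\<^sup>2 / 2"
        by (simp add: g_def o_def)
    qed
    fix i
    show "AE \<omega> in M. norm (g (i + N) \<omega>) \<le> 1 / b\<^sup>2 * exp (h * \<bar>Y \<omega>\<bar>)"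
    proof (intro AE_I2)
      fix \<omega>
      define u where "u = t (i + N)"
      have u: "\<bar>u\<bar> \<le> b" "u \<noteq> 0" using N[of "i + N"] t0 by (auto simp: u_def)
      have "\<bar>g (i + N) \<omega>\<bar> \<le> (u * Y \<omega>)\<^sup>2 / 2 * exp \<bar>u * Y \<omega>\<bar> / u\<^sup>2"
        unfolding g_def u_def[symmetric] abs_divide abs_power2
        by (intro divide_right_mono exp_minus_linear_bound) auto
      also have "\<dots> = (Y \<omega>)\<^sup>2 / 2 * exp \<bar>u * Y \<omega>\<bar>"
        using u by (simp add: power_mult_distrib)
      also have "\<dots> \<le> (1 / b\<^sup>2 * exp (b * \<bar>Y \<omega>\<bar>)) * exp (b * \<bar>Y \<omega>\<bar>)"
      proof (intro mult_mono)
        show "(Y \<omega>)\<^sup>2 / 2 \<le> 1 / b\<^sup>2 * exp (b * \<bar>Y \<omega>\<bar>)"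
          using square_le_exp[of "b * Y \<omega>"] b by (simp add: field_simps abs_mult power_mult_distrib)
        show "exp \<bar>u * Y \<omega>\<bar> \<le> exp (b * \<bar>Y \<omega>\<bar>)"
          using u by (simp add: abs_mult mult_right_mono)
      qed auto
      also have "\<dots> = 1 / b\<^sup>2 * exp (h * \<bar>Y \<omega>\<bar>)"
        by (simp add: b_def mult_exp_exp)
      finally show "norm (g (i + N) \<omega>) \<le> 1 / b\<^sup>2 * exp (h * \<bar>Y \<omega>\<bar>)" by simp
    qed
  qed measurable
  have "expectation (g (i + N)) =
      (expectation (\<lambda>\<omega>. exp (t (i + N) * Y \<omega>)) - 1 - t (i + N) * expectation Y) / (t (i + N))\<^sup>2" for i
  proof -
    have "\<bar>t (i + N)\<bar> \<le> h" using N[of "i + N"] h by (simp add: b_def)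
    then have [simp]: "integrable M (\<lambda>\<omega>. exp (t (i + N) * Y \<omega>))"
      by (rule integrable_exp_mult)
    show ?thesis
      using integrable_of_exp by (simp add: g_def prob_space)
  qed
  with lim have "(\<lambda>i. ((\<lambda>t. (expectation (\<lambda>\<omega>. exp (t * Y \<omega>)) - 1 - t * expectation Y) / t\<^sup>2) \<circ> t) (i + N))
      \<longlonglongrightarrow> expectation (\<lambda>\<omega>. (Y \<omega>)\<^sup>2) / 2"
    by (simp add: o_def)
  then show "((\<lambda>t. (expectation (\<lambda>\<omega>. exp (t * Y \<omega>)) - 1 - t * expectation Y) / t\<^sup>2) \<circ> t)
      \<longlonglongrightarrow> expectation (\<lambda>\<omega>. (Y \<omega>)\<^sup>2) / 2"
    by (rule LIMSEQ_offset)
qed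

lemma moments_from_mgf:
  assumes lim: "((\<lambda>t. (expectation (\<lambda>\<omega>. exp (t * Y \<omega>)) - 1) / t\<^sup>2) \<longlongrightarrow> c) (at_right 0)"
  shows "expectation Y = 0" and "expectation (\<lambda>\<omega>. (Y \<omega>)\<^sup>2) = 2 * c"
proof -
  let ?m = "\<lambda>t. expectation (\<lambda>\<omega>. exp (t * Y \<omega>))"
  have ev: "\<forall>\<^sub>F t::real in at_right 0. t > 0" by (rule eventually_at_right_less)
  have 1: "((\<lambda>t. (?m t - 1 - t * expectation Y) / t\<^sup>2)
      \<longlongrightarrow> expectation (\<lambda>\<omega>. (Y \<omega>)\<^sup>2) / 2) (at_right 0)"
    using mgf_second_order by (simp add: filterlim_at_split)
  \<comment> \<open>Both quotients have finite limits, so \<open>t\<close> times their difference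
    tends to 0; but this product is constantly the mean.\<close>
  have "((\<lambda>t. t * ((?m t - 1) / t\<^sup>2 - (?m t - 1 - t * expectation Y) / t\<^sup>2))
      \<longlongrightarrow> 0 * (c - expectation (\<lambda>\<omega>. (Y \<omega>)\<^sup>2) / 2)) (at_right 0)"
    by (intro tendsto_intros lim 1)
  then have "((\<lambda>t::real. expectation Y) \<longlongrightarrow> 0) (at_right 0)"
    by (rule filterlim_cong[THEN iffD1, rotated -1, OF _ _ _ eventually_mono[OF ev]])
       (simp_all add: field_simps power2_eq_square)
  then show E: "expectation Y = 0"
    by (simp add: tendsto_const_iff)
  show "expectation (\<lambda>\<omega>. (Y \<omega>)\<^sup>2) = 2 * c"
    using tendsto_unique[OF _ lim 1[unfolded E, simplified]] by simp
qed

end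

end

section \<open>Upper half of the law of the iterated logarithm\<close>

text \<open>A general setting for the law of the iterated logarithm: the sine is forgotten, leaving
  the variance \<open>s\<close> and a two-sided exponential moment of order \<open>h\<close>.
  Indices start at 0, whereas the factors of \<open>sine_prod\<close> start at 1.\<close>

locale iid_exp_moment = prob_space +
  fixes Y :: "nat \<Rightarrow> 'a \<Rightarrow> real" and s h :: real
  assumes indep: "indep_vars (\<lambda>_. borel) Y UNIV"
    and ident: "\<And>i. distr M borel (Y i) = distr M borel (Y 0)"
    and h_pos: "h > 0" and int_exp_abs: "integrable M (\<lambda>\<omega>. exp (h * \<bar>Y 0 \<omega>\<bar>))"
    and mean_0: "expectation (Y 0) = 0"
    and second_moment: "expectation (\<lambda>\<omega>. (Y 0 \<omega>)\<^sup>2) = s"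
    and s_pos: "s > 0"
begin

definition S :: "nat \<Rightarrow> 'a \<Rightarrow> real" where
  "S n \<omega> = (\<Sum>i<n. Y i \<omega>)"

definition mgf :: "real \<Rightarrow> real" where
  "mgf t = expectation (\<lambda>\<omega>. exp (t * Y 0 \<omega>))"

section \<open>Independence and moments of the partial sums\<close>

lemma Y_measurable [measurable]: "Y i \<in> borel_measurable M"
  using indep by (auto simp: indep_vars_def)

lemma S_measurable [measurable]: "S n \<in> borel_measurable M"
  unfolding S_def by measurable

lemma S_0 [simp]: "S 0 \<omega> = 0" and S_Suc: "S (Suc n) \<omega> = S n \<omega> + Y n \<omega>"
  by (simp_all add: S_def)

lemma integral_ident:
  fixes f :: "real \<Rightarrow> real"
  assumes [measurable]: "f \<in> borel_measurable borel"
  shows "expectation (\<lambda>\<omega>. f (Y i \<omega>)) = expectation (\<lambda>\<omega>. f (Y 0 \<omega>))"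
    and "integrable M (\<lambda>\<omega>. f (Y i \<omega>)) \<longleftrightarrow> integrable M (\<lambda>\<omega>. f (Y 0 \<omega>))"
proof -
  have Y: "random_variable borel (Y j)" for j using indep by (auto simp: indep_vars_def)
  show "expectation (\<lambda>\<omega>. f (Y i \<omega>)) = expectation (\<lambda>\<omega>. f (Y 0 \<omega>))"
    using integral_distr[OF Y[of i] assms] integral_distr[OF Y[of 0] assms] ident[of i] by metis
  show "integrable M (\<lambda>\<omega>. f (Y i \<omega>)) \<longleftrightarrow> integrable M (\<lambda>\<omega>. f (Y 0 \<omega>))"
    using integrable_distr_eq[OF Y[of i] assms] integrable_distr_eq[OF Y[of 0] assms] ident[of i] by metis
qed

lemma indep_var_blocks:
  fixes f g :: "(nat \<Rightarrow> real) \<Rightarrow> real"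
  assumes "A \<inter> B = {}" "f \<in> borel_measurable (PiM A (\<lambda>_. borel))"
    "g \<in> borel_measurable (PiM B (\<lambda>_. borel))"
  shows "indep_var borel (\<lambda>\<omega>. f (\<lambda>i\<in>A. Y i \<omega>)) borel (\<lambda>\<omega>. g (\<lambda>i\<in>B. Y i \<omega>))"
  using indep_var_compose[OF indep_var_restrict[OF indep assms(1)] assms(2,3)]
  by (simp add: o_def)

lemma indep_var_next:
  assumes "f \<in> borel_measurable (PiM {..<n} (\<lambda>_. borel))" "g \<in> borel_measurable borel"
  shows "indep_var borel (\<lambda>\<omega>. f (\<lambda>i\<in>{..<n}. Y i \<omega>) :: real) borel (\<lambda>\<omega>. g (Y n \<omega>) :: real)"
proof -
  have [measurable]: "g \<in> borel_measurable borel" by fact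
  have "indep_var borel (\<lambda>\<omega>. f (\<lambda>i\<in>{..<n}. Y i \<omega>)) borel (\<lambda>\<omega>. g ((\<lambda>i\<in>{n}. Y i \<omega>) n))"
    by (rule indep_var_blocks[where g = "\<lambda>x. g (x n)"]) (use assms in auto)
  then show ?thesis by simp
qed

lemma integrable_exp_Y: "\<bar>t\<bar> \<le> h \<Longrightarrow> integrable M (\<lambda>\<omega>. exp (t * Y i \<omega>))"
  using integral_ident(2)[of "\<lambda>x. exp (t * x)" i]
    integrable_exp_mult[OF Y_measurable h_pos int_exp_abs, of t] by simp

lemma integrable_Y: "integrable M (Y i)" "integrable M (\<lambda>\<omega>. (Y i \<omega>)\<^sup>2)"
  using integral_ident(2)[of "\<lambda>x. x" i] integral_ident(2)[of "\<lambda>x. x\<^sup>2" i]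
    integrable_of_exp[OF Y_measurable h_pos int_exp_abs] integrable_square_of_exp[OF Y_measurable h_pos int_exp_abs]
  by auto

lemma expectation_Y: "expectation (Y i) = 0" "expectation (\<lambda>\<omega>. (Y i \<omega>)\<^sup>2) = s"
  using integral_ident(1)[of "\<lambda>x. x" i] integral_ident(1)[of "\<lambda>x. x\<^sup>2" i] mean_0 second_moment
  by auto

text \<open>From \<open>1 + x \<le> exp x\<close> and the vanishing mean. In the maximal inequality
  it allows the stopped part to be multiplied by \<open>mgf t\<close> as well.\<close>

lemma mgf_ge_1:
  assumes "\<bar>t\<bar> \<le> h" shows "mgf t \<ge> 1"
proof -
  have "expectation (\<lambda>\<omega>. 1 + t * Y 0 \<omega>) \<le> mgf t"
    unfolding mgf_def using integrable_Y integrable_exp_Y[OF assms]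
    by (intro integral_mono) auto
  then show ?thesis using integrable_Y mean_0 by (simp add: prob_space)
qed

lemma S_moments:
  "integrable M (S n)" "integrable M (\<lambda>\<omega>. (S n \<omega>)\<^sup>2)"
  "expectation (S n) = 0" "expectation (\<lambda>\<omega>. (S n \<omega>)\<^sup>2) = real n * s"
proof -
  have "integrable M (S n) \<and> integrable M (\<lambda>\<omega>. (S n \<omega>)\<^sup>2) \<and> expectation (S n) = 0 \<and>
    expectation (\<lambda>\<omega>. (S n \<omega>)\<^sup>2) = real n * s"
  proof (induction n)
    case 0
    have "S 0 = (\<lambda>_. 0)" by (simp add: fun_eq_iff)
    then show ?case by simp
  next
    case (Suc n)
    have Sn: "S n = (\<lambda>\<omega>. (\<lambda>x. \<Sum>i<n. x i) (\<lambda>i\<in>{..<n}. Y i \<omega>))"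
      by (simp add: S_def fun_eq_iff)
    have iv: "indep_var borel (S n) borel (Y n)"
      unfolding Sn by (rule indep_var_next[where g = "\<lambda>x. x"]) measurable
    have eq: "S (Suc n) = (\<lambda>\<omega>. S n \<omega> + Y n \<omega>)"
      "(\<lambda>\<omega>. (S (Suc n) \<omega>)\<^sup>2) = (\<lambda>\<omega>. (S n \<omega>)\<^sup>2 + 2 * (S n \<omega> * Y n \<omega>) + (Y n \<omega>)\<^sup>2)"
      by (auto simp: S_Suc fun_eq_iff power2_sum)
    show ?case
      unfolding eq(2) unfolding eq(1) using Suc.IH integrable_Y[of n] expectation_Y[of n]
        indep_var_integrable[OF iv] indep_var_lebesgue_integral[OF iv]
      by (simp add: algebra_simps)
  qed
  then show "integrable M (S n)" "integrable M (\<lambda>\<omega>. (S n \<omega>)\<^sup>2)"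
    "expectation (S n) = 0" "expectation (\<lambda>\<omega>. (S n \<omega>)\<^sup>2) = real n * s" by auto
qed

lemma S_Chebyshev:
  assumes "a > 0"
  shows "prob {\<omega> \<in> space M. \<bar>S n \<omega>\<bar> \<ge> a} \<le> real n * s / a\<^sup>2"
  using Chebyshev_inequality[of "S n" a] assms S_moments[of n] by simp

text \<open>Capping the exponential at its first passage above \<open>l\<close> can only lower it,
  so the Chernoff bound for the endpoint holds for the whole running maximum without any loss in the
  constant.\<close>

lemma maximal_inequality:
  assumes t: "0 \<le> t" "t \<le> h" and l: "l > 0"
  shows "prob {\<omega> \<in> space M. \<exists>k\<le>n. S k \<omega> \<ge> l} \<le> exp (- t * l) * mgf t ^ n"
proof -
  define A where "A = (\<lambda>n \<omega>. \<exists>k\<le>n. S k \<omega> \<ge> l)"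
  \<comment> \<open>The process stopped at the first passage above \<open>l\<close>, with overshoot removed.\<close>
  define V where "V = (\<lambda>n \<omega>. if A n \<omega> then exp (t * l) else exp (t * S n \<omega>))"
  \<comment> \<open>The part not yet stopped. It is bounded, hence integrable, and depends on the
    first \<open>n\<close> variables only, hence is independent of \<open>Y n\<close>.\<close>
  define W where "W = (\<lambda>n \<omega>. if A n \<omega> then 0 else exp (t * S n \<omega>))"
  have [measurable]: "Measurable.pred M (A n)" for n
    unfolding A_def by measurable
  have [measurable]: "V n \<in> borel_measurable M" "W n \<in> borel_measurable M" for n
    unfolding V_def W_def by measurable
  have W: "0 \<le> W n \<omega>" "W n \<omega> \<le> exp (t * l)" for n \<omega>
    using t mult_left_mono[of "S n \<omega>" l t] by (auto simp: W_def A_def not_le)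
  have intW: "integrable M (W n)" for n
    by (rule integrable_const_bound[of _ "exp (t * l)"]) (use W in auto)
  have "integrable M (V n) \<and> expectation (V n) \<le> mgf t ^ n" for n
  proof (induction n)
    case 0
    have "V 0 = (\<lambda>_. 1)" using l by (auto simp: V_def A_def)
    then show ?case by (simp add: prob_space)
  next
    case (Suc n)
    \<comment> \<open>For \<open>k \<le> n\<close> the intersection is just \<open>{..<k}\<close>;
      it keeps every coordinate inside \<open>{..<n}\<close>, so that each sum is measurable on that
      product space.\<close>
    define W' where "W' = (\<lambda>x::nat \<Rightarrow> real. if \<exists>k\<le>n. (\<Sum>i\<in>{..<k} \<inter> {..<n}. x i) \<ge> l then 0 else exp (t * (\<Sum>i<n. x i)))"
    have [measurable]: "W' \<in> borel_measurable (PiM {..<n} (\<lambda>_. borel))"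
      unfolding W'_def by measurable
    have "{..<k} \<inter> {..<n} = {..<k}" if "k \<le> n" for k using that by auto
    then have Weq: "W n = (\<lambda>\<omega>. W' (\<lambda>i\<in>{..<n}. Y i \<omega>))"
      by (auto simp: W_def W'_def A_def S_def fun_eq_iff)
    have th: "\<bar>t\<bar> \<le> h" using t by simp
    have iv: "indep_var borel (W n) borel (\<lambda>\<omega>. exp (t * Y n \<omega>))"
      unfolding Weq by (rule indep_var_next[where g = "\<lambda>x. exp (t * x)"]) measurable
    have intWY: "integrable M (\<lambda>\<omega>. W n \<omega> * exp (t * Y n \<omega>))"
      and EWY: "expectation (\<lambda>\<omega>. W n \<omega> * exp (t * Y n \<omega>)) = expectation (W n) * mgf t"
      using indep_var_integrable[OF iv intW integrable_exp_Y[OF th]]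
        indep_var_lebesgue_integral[OF iv intW integrable_exp_Y[OF th]]
        integral_ident(1)[of "\<lambda>x. exp (t * x)" n] by (auto simp: mgf_def)
    let ?U = "\<lambda>\<omega>. (V n \<omega> - W n \<omega>) + W n \<omega> * exp (t * Y n \<omega>)"
    have VW: "V n \<omega> - W n \<omega> \<ge> 0" for \<omega> by (auto simp: V_def W_def)
    have step: "V (Suc n) \<omega> \<le> ?U \<omega>" for \<omega>
    proof (cases "A n \<omega>")
      case True
      then have "A (Suc n) \<omega>" by (auto simp: A_def intro: le_SucI)
      then show ?thesis using True by (simp add: V_def W_def)
    next
      case False
      then have "A (Suc n) \<omega> \<longleftrightarrow> S (Suc n) \<omega> \<ge> l"
        by (auto simp: A_def le_Suc_eq)
      then have "V (Suc n) \<omega> \<le> exp (t * S (Suc n) \<omega>)"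
        using t by (auto simp: V_def mult_left_mono)
      also have "\<dots> = W n \<omega> * exp (t * Y n \<omega>)"
        using False by (simp add: W_def S_Suc exp_add algebra_simps)
      finally show ?thesis using VW[of \<omega>] by linarith
    qed
    have intU: "integrable M ?U"
      using Suc.IH intW intWY by simp
    have "integrable M (V (Suc n))"
    proof (rule Bochner_Integration.integrable_bound[OF intU])
      have "norm (V (Suc n) \<omega>) \<le> norm (?U \<omega>)" for \<omega>
      proof -
        have "V (Suc n) \<omega> \<ge> 0" by (simp add: V_def)
        then show ?thesis using step[of \<omega>] by simp
      qed
      then show "AE \<omega> in M. norm (V (Suc n) \<omega>) \<le> norm (?U \<omega>)" by simp
    qed measurable
    moreover have "expectation (V (Suc n)) \<le> expectation ?U"
      by (intro integral_mono calculation intU step)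
    \<comment> \<open>The factor 1 on the stopped part is then raised to \<open>mgf t\<close>, after
      which the two parts add up to \<open>expectation (V n) * mgf t\<close>.\<close>
    moreover have "expectation ?U = (expectation (V n) - expectation (W n)) * 1 + expectation (W n) * mgf t"
      using Suc.IH intW intWY EWY by simp
    moreover have "\<dots> \<le> (expectation (V n) - expectation (W n)) * mgf t + expectation (W n) * mgf t"
    proof -
      have "expectation (\<lambda>\<omega>. V n \<omega> - W n \<omega>) \<ge> 0" by (intro Bochner_Integration.integral_nonneg VW)
      then show ?thesis
        using mgf_ge_1[OF th] Suc.IH intW by (intro add_right_mono mult_left_mono) simp_all
    qed
    moreover have "(expectation (V n) - expectation (W n)) * mgf t + expectation (W n) * mgf t \<le> mgf t ^ Suc n"
      using Suc.IH mgf_ge_1[OF th] by (simp add: algebra_simps mult_left_mono)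
    ultimately show ?case by linarith
  qed
  note V = this[of n]
  have "exp (t * l) * prob {\<omega> \<in> space M. A n \<omega>} =
      expectation (\<lambda>\<omega>. exp (t * l) * indicator {\<omega> \<in> space M. A n \<omega>} \<omega>)"
    by simp
  also have "\<dots> \<le> expectation (V n)"
    using V by (intro integral_mono integrable_mult_right integrable_real_indicator)
      (auto simp: V_def less_top[symmetric] split: split_indicator)
  also have "\<dots> \<le> mgf t ^ n" using V by simp
  finally show ?thesis by (simp add: A_def exp_minus field_simps)
qed

lemma mgf_le_exp_square:
  assumes "c > 1"
  shows "\<forall>\<^sub>F t in at_right 0. mgf t \<le> exp (c * s * t\<^sup>2 / 2)"
proof -
  have "((\<lambda>t. (mgf t - 1) / t\<^sup>2) \<longlongrightarrow> s / 2) (at_right 0)"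
    using mgf_second_order[OF Y_measurable h_pos int_exp_abs]
    by (simp add: mean_0 second_moment mgf_def filterlim_at_split)
  moreover have "s / 2 < c * s / 2" using assms s_pos by simp
  ultimately have "\<forall>\<^sub>F t in at_right 0. (mgf t - 1) / t\<^sup>2 < c * s / 2"
    by (rule order_tendstoD)
  then show ?thesis using eventually_at_right_less
  proof eventually_elim
    case (elim t)
    then have "mgf t \<le> 1 + c * s * t\<^sup>2 / 2" by (simp add: field_simps)
    also have "\<dots> \<le> exp (c * s * t\<^sup>2 / 2)" by (rule exp_ge_add_one_self)
    finally show ?case .
  qed
qed

lemma lil_upper:
  assumes c: "c > 1"
  shows "AE \<omega> in M. \<forall>\<^sub>F n in sequentially. S n \<omega> \<le> c * sqrt (2 * s * (real n * ln (ln (real n))))"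
proof -
  \<comment> \<open>With this choice the exponent \<open>(1 - \<delta>) c\<close> below equals \<open>(c + 1) / 2 > 1\<close>.\<close>
  define \<delta> where "\<delta> = (1 - 1 / c) / 2"
  define \<beta> where "\<beta> = (1 - \<delta>) * c"
  have \<delta>: "\<delta> > 0" and \<beta>: "\<beta> > 1" using c by (auto simp: \<delta>_def \<beta>_def field_simps)
  define a where "a = ln c"
  have a: "a > 0" using c by (simp add: a_def)
  \<comment> \<open>The target value at \<open>n = c ^ k\<close>, since
    \<open>ln (c ^ k) = real k * a\<close>. The maximum is taken up to \<open>c ^ Suc k\<close>,
    which costs one of the two factors \<open>c\<close> in the square of \<open>l k\<close>; the
    other one remains in the exponent \<beta>.\<close>
  define l where "l = (\<lambda>k. c * sqrt (2 * s * (c ^ k * ln (real k * a))))"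
  \<comment> \<open>The minimiser of the Gaussian exponent
    \<open>- t * l k + c ^ Suc k * s * t\<^sup>2 / 2\<close>.\<close>
  define t where "t = (\<lambda>k. l k / (s * c ^ Suc k))"
  define N where "N = (\<lambda>k. nat \<lfloor>c ^ Suc k\<rfloor>)"
  define E where "E = (\<lambda>k. {\<omega> \<in> space M. \<exists>j\<le>N k. S j \<omega> \<ge> l k})"
  have [measurable]: "E k \<in> sets M" for k unfolding E_def by measurable
  have ck: "c ^ k = exp (real k * a)" for k using c by (simp add: a_def exp_of_nat_mult)
  have large: "\<forall>\<^sub>F k in sequentially. real k * a > 1"
    using a by real_asymp
  have t_sqrt: "t k = sqrt (2 / s * (ln (real k * a) / exp (real k * a)))" if "real k * a > 1" for k
  proof -
    have "(t k)\<^sup>2 = 2 / s * (ln (real k * a) / c ^ k)"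
      using c s_pos that by (simp add: t_def l_def power_divide power_mult_distrib)
        (simp add: power2_eq_square)
    moreover have "t k \<ge> 0" using c s_pos that by (simp add: t_def l_def)
    ultimately show ?thesis by (metis ck real_sqrt_unique)
  qed
  \<comment> \<open>Used twice: the quadratic bound on \<open>mgf\<close> holds only near 0, and the
    maximal inequality needs \<open>t k \<le> h\<close>.\<close>
  have t_lim: "filterlim t (at_right 0) sequentially"
  proof -
    have "((\<lambda>x::real. ln x / exp x) \<longlongrightarrow> 0) at_top" by real_asymp
    moreover have "filterlim (\<lambda>k. real k * a) at_top sequentially" using a by real_asymp
    ultimately have "(\<lambda>k. ln (real k * a) / exp (real k * a)) \<longlonglongrightarrow> 0"
      by (rule filterlim_compose)
    then have "(\<lambda>k. sqrt (2 / s * (ln (real k * a) / exp (real k * a)))) \<longlonglongrightarrow> sqrt (2 / s * 0)"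
      by (intro tendsto_intros)
    then have "t \<longlonglongrightarrow> 0"
      by (rule filterlim_cong[THEN iffD1, rotated -1])
        (use large in \<open>auto elim!: eventually_mono simp: t_sqrt\<close>)
    moreover have "\<forall>\<^sub>F k in sequentially. t k > 0"
      using large by eventually_elim (use c s_pos in \<open>simp add: t_def l_def\<close>)
    ultimately show ?thesis
      by (auto simp: filterlim_at elim!: eventually_mono)
  qed
  have "\<forall>\<^sub>F u in at_right 0. mgf u \<le> exp ((1 + \<delta>) * s * u\<^sup>2 / 2)"
    using \<delta> by (intro mgf_le_exp_square) simp
  then have mgf_t: "\<forall>\<^sub>F k in sequentially. mgf (t k) \<le> exp ((1 + \<delta>) * s * (t k)\<^sup>2 / 2)"
    by (rule eventually_compose_filterlim[OF _ t_lim])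
  have "\<forall>\<^sub>F u in at_right 0. 0 < u \<and> u < h"
    using h_pos by (auto simp: eventually_at_right_field)
  then have t_h: "\<forall>\<^sub>F k in sequentially. 0 < t k \<and> t k < h"
    by (rule eventually_compose_filterlim[OF _ t_lim])
  have prob_E: "\<forall>\<^sub>F k in sequentially. prob (E k) \<le> (real k * a) powr (- \<beta>)"
    using large mgf_t t_h
  proof eventually_elim
    case (elim k)
    define L where "L = ln (real k * a)"
    define C where "C = c ^ Suc k"
    have L: "L > 0" using elim by (simp add: L_def)
    have C: "C > 0" using c by (simp add: C_def)
    have l: "l k > 0" "(l k)\<^sup>2 = 2 * s * c * C * L"
      using c s_pos L
      by (simp_all add: l_def L_def C_def power_mult_distrib power2_eq_square[of c])
    have "prob (E k) \<le> exp (- t k * l k) * mgf (t k) ^ N k"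
      unfolding E_def using elim l by (intro maximal_inequality) auto
    also have "\<dots> \<le> exp (- t k * l k) * exp ((1 + \<delta>) * s * (t k)\<^sup>2 / 2) ^ N k"
      using elim mgf_ge_1[of "t k"] by (intro mult_left_mono power_mono) auto
    also have "\<dots> = exp (- t k * l k + real (N k) * ((1 + \<delta>) * s * (t k)\<^sup>2 / 2))"
      by (simp only: exp_add exp_of_nat_mult)
    also have "\<dots> \<le> exp (- t k * l k + C * ((1 + \<delta>) * s * (t k)\<^sup>2 / 2))"
      using C \<delta> s_pos by (intro exp_le_cancel_iff[THEN iffD2] add_left_mono mult_right_mono)
        (auto simp: N_def C_def)
    also have "- t k * l k + C * ((1 + \<delta>) * s * (t k)\<^sup>2 / 2) = - ((1 - \<delta>) / (2 * s * C)) * (l k)\<^sup>2"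
      unfolding t_def C_def[symmetric] using C s_pos
      by (simp add: field_simps power2_eq_square)
    also have "\<dots> = - \<beta> * L"
      unfolding l(2) \<beta>_def using C s_pos by (simp add: field_simps)
    also have "exp (- \<beta> * L) = (real k * a) powr (- \<beta>)"
      using elim a by (cases "k = 0") (auto simp: powr_def L_def)
    finally show ?case .
  qed
  have "summable (\<lambda>k. (real k * a) powr (- \<beta>))"
    using \<beta> a by (simp add: powr_mult summable_mult2 summable_real_powr_iff)
  then have "summable (\<lambda>k. prob (E k))"
    by (rule summable_comparison_test_ev[rotated]) (use prob_E in simp)
  then have "AE \<omega> in M. \<forall>\<^sub>F k in sequentially. \<omega> \<in> space M - E k"
    by (intro borel_cantelli_AE1) (auto simp: less_top[symmetric])
  then show ?thesis
  proof eventually_elim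
    case (elim \<omega>)
    then have "\<forall>\<^sub>F k in sequentially. \<omega> \<in> space M - E k \<and> real k * a > 1"
      using large by eventually_elim simp
    then obtain K where K: "\<And>k. k \<ge> K \<Longrightarrow> \<omega> \<in> space M - E k \<and> real k * a > 1"
      by (auto simp: eventually_sequentially)
    have "\<forall>\<^sub>F n in sequentially. real n \<ge> c ^ K"
      by real_asymp
    then show ?case using eventually_ge_at_top[of 1]
    proof eventually_elim
      case (elim n)
      define k where "k = nat \<lfloor>log c (real n)\<rfloor>"
      have "log c (real n) \<ge> 0" using c elim by simp
      then have "real k \<le> log c (real n)" "log c (real n) < real (Suc k)"
        unfolding k_def by linarith+
      then have "c powr real k \<le> real n" "real n < c powr real (Suc k)"
        using c elim by (simp_all add: le_log_iff log_less_iff)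
      then have kn: "c ^ k \<le> real n" "real n < c ^ Suc k"
        using c by (simp_all only: powr_realpow)
      have "k \<ge> K"
      proof (rule ccontr)
        assume "\<not> K \<le> k"
        then have "c ^ Suc k \<le> c ^ K" using c by (intro power_increasing) auto
        then show False using kn elim by linarith
      qed
      note K = K[OF this]
      have "n \<le> N k" using kn unfolding N_def by linarith
      with K have "\<not> l k \<le> S n \<omega>" unfolding E_def by blast
      then have "S n \<omega> < l k" by simp
      also have "l k \<le> c * sqrt (2 * s * (real n * ln (ln (real n))))"
      proof -
        have "real k * a = ln (c ^ k)" using c by (simp add: a_def ln_realpow)
        also have "\<dots> \<le> ln (real n)" using kn c by (intro ln_mono) auto
        finally have "ln (real k * a) \<le> ln (ln (real n))" using K by (intro ln_mono) auto
        then have "c ^ k * ln (real k * a) \<le> real n * ln (ln (real n))"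
          using kn K c by (intro mult_mono) auto
        then show ?thesis
          unfolding l_def using c s_pos by (intro mult_left_mono real_sqrt_le_mono) auto
      qed
      finally show ?case by simp
    qed
  qed
qed

end

section \<open>Lower half of the law of the iterated logarithm\<close>

text \<open>The second Borel-Cantelli lemma for events read off independent variables: by
  \<open>1 - p \<le> exp (- p)\<close>, the probability that none of a run of events occurs is at
  most the exponential of minus the sum, which diverges.\<close>

lemma (in prob_space) borel_cantelli_indep_vars:
  assumes indep: "indep_vars N Z (UNIV :: nat set)" and A: "\<And>k. A k \<in> sets (N k)"
    and div: "\<not> summable (\<lambda>k. prob (Z k -` A k \<inter> space M))"
  shows "AE \<omega> in M. \<exists>\<^sub>\<infinity>k. Z k \<omega> \<in> A k"
proof -
  define p where "p = (\<lambda>k. prob (Z k -` A k \<inter> space M))"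
  define C where "C = (\<lambda>k. Z k -` (space (N k) - A k) \<inter> space M)"
  have rv: "Z k \<in> measurable M (N k)" for k
    using indep by (auto simp: indep_vars_def)
  have ev: "Z k -` A k \<inter> space M \<in> events" for k
    using rv A by (rule measurable_sets)
  have C: "C k = space M - (Z k -` A k \<inter> space M)" for k
    using measurable_space[OF rv] by (auto simp: C_def)
  have C_ev [measurable]: "C k \<in> events" for k unfolding C using ev by auto
  have prob_C: "prob (C k) \<le> exp (- p k)" for k
    using prob_compl[OF ev[of k]] exp_ge_add_one_self[of "- p k"] by (simp add: C p_def)
  have "prob (\<Inter>k\<in>{m..}. C k) = 0" for m
  proof (rule ccontr)
    define e where "e = prob (\<Inter>k\<in>{m..}. C k)"
    assume "prob (\<Inter>k\<in>{m..}. C k) \<noteq> 0"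
    then have e: "e > 0" by (simp add: e_def zero_less_measure_iff)
    \<comment> \<open>The summand \<open>real m\<close> pays for the first \<open>m\<close> terms,
      each at most 1; the rest must then exceed \<open>- ln e\<close>.\<close>
    have "\<not> (\<forall>n. sum p {..<n} \<le> real m - ln e)"
      using summableI_nonneg_bounded[of p "real m - ln e"] div unfolding p_def by auto
    then obtain n where n: "sum p {..<n} > real m - ln e"
      by (auto simp: not_le)
    \<comment> \<open>The maximum keeps \<open>{m..<n'}\<close> nonempty, as the finite intersection
      and the product formula require.\<close>
    define n' where "n' = max n (Suc m)"
    have "sum p {..<n} \<le> sum p {..<n'}"
      by (intro sum_mono2) (auto simp: n'_def p_def)
    also have "{..<n'} = {..<m} \<union> {m..<n'}" by (auto simp: n'_def)
    also have "sum p \<dots> = sum p {..<m} + sum p {m..<n'}"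
      by (intro sum.union_disjoint) auto
    also have "sum p {..<m} \<le> real m"
      using sum_bounded_above[of "{..<m}" p 1] by (simp add: p_def)
    finally have "sum p {m..<n'} > - ln e" using n by simp
    have "e \<le> prob (\<Inter>k\<in>{m..<n'}. C k)"
      unfolding e_def by (intro finite_measure_mono sets.finite_INT) (auto simp: n'_def)
    also have "\<dots> = (\<Prod>k\<in>{m..<n'}. prob (C k))"
      unfolding C_def by (rule indep_varsD[OF indep]) (use A in \<open>auto simp: n'_def\<close>)
    also have "\<dots> \<le> (\<Prod>k\<in>{m..<n'}. exp (- p k))"
      using prob_C by (intro prod_mono) auto
    also have "\<dots> = exp (- sum p {m..<n'})"
      by (simp add: exp_sum[symmetric] sum_negf)
    also have "\<dots> < exp (ln e)" using \<open>sum p {m..<n'} > - ln e\<close> by simp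
    finally show False using e by simp
  qed
  then have "AE \<omega> in M. \<omega> \<notin> (\<Inter>k\<in>{m..}. C k)" for m
    by (intro AE_not_in) (simp add: null_sets_def emeasure_eq_measure)
  then have "AE \<omega> in M. \<forall>m. \<omega> \<notin> (\<Inter>k\<in>{m..}. C k)"
    by (simp add: AE_all_countable)
  then show ?thesis
  proof (rule AE_mp, intro AE_I2 impI)
    fix \<omega> assume "\<omega> \<in> space M" "\<forall>m. \<omega> \<notin> (\<Inter>k\<in>{m..}. C k)"
    then show "\<exists>\<^sub>\<infinity>k. Z k \<omega> \<in> A k"
      unfolding INFM_nat_le C by auto
  qed
qed

text \<open>The density decreases on the unit interval from \<open>a\<close> to
  \<open>a + 1\<close>, so its value at the right end bounds the mass from below. This is crude, but
  only the leading term of the exponent matters.\<close>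

lemma std_normal_tail_lower:
  assumes "a \<ge> 0"
  shows "exp (- (a + 1)\<^sup>2 / 2) / sqrt (2 * pi) \<le> 1 - cdf std_normal_distribution a"
proof -
  interpret real_distribution std_normal_distribution by (rule real_dist_normal_dist)
  have "ennreal (std_normal_density (a + 1)) = (\<integral>\<^sup>+x. ennreal (std_normal_density (a + 1)) * indicator {a<..a + 1} x \<partial>lborel)"
    by (subst nn_integral_cmult_indicator) auto
  also have "\<dots> \<le> (\<integral>\<^sup>+x. ennreal (std_normal_density x) * indicator {a<..a + 1} x \<partial>lborel)"
  proof (intro nn_integral_mono)
    fix x
    have "x\<^sup>2 \<le> (a + 1)\<^sup>2" if "x \<in> {a<..a + 1}"
      using that assms by (intro power_mono) auto
    then show "ennreal (std_normal_density (a + 1)) * indicator {a<..a + 1} x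
        \<le> ennreal (std_normal_density x) * indicator {a<..a + 1} x"
      by (auto simp: std_normal_density_def split: split_indicator intro!: ennreal_leI divide_right_mono)
  qed
  also have "\<dots> = emeasure std_normal_distribution {a<..a + 1}"
    by (simp add: emeasure_density)
  also have "\<dots> \<le> emeasure std_normal_distribution (space std_normal_distribution - {..a})"
    by (intro emeasure_mono) auto
  finally have "std_normal_density (a + 1) \<le> prob (space std_normal_distribution - {..a})"
    by (simp add: emeasure_eq_measure)
  also have "\<dots> = 1 - cdf std_normal_distribution a"
    by (subst prob_compl) (auto simp: cdf_def)
  finally show ?thesis by (simp add: std_normal_density_def)
qed

section \<open>Sums over blocks and lower bounds for their tails\<close>

context iid_exp_moment begin

definition block :: "nat \<Rightarrow> nat \<Rightarrow> 'a \<Rightarrow> real" where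
  "block a n \<omega> = (\<Sum>i\<in>{a..<a + n}. Y i \<omega>)"

lemma block_measurable [measurable]: "block a n \<in> borel_measurable M"
  unfolding block_def by measurable

lemma S_add: "S (a + n) \<omega> = S a \<omega> + block a n \<omega>"
  unfolding S_def block_def by (simp add: lessThan_atLeast0 sum.atLeastLessThan_concat)

lemma indep_var_block_next: "indep_var borel (block a n) borel (Y (a + n))"
proof -
  have "indep_var borel (\<lambda>\<omega>. (\<lambda>x. \<Sum>i\<in>{a..<a + n}. x i) (\<lambda>i\<in>{a..<a + n}. Y i \<omega>))
      borel (\<lambda>\<omega>. (\<lambda>x. x (a + n)) (\<lambda>i\<in>{a + n}. Y i \<omega>))"
    by (rule indep_var_blocks) auto
  then show ?thesis by (simp add: block_def[abs_def])
qed

lemma indep_var_S_block: "indep_var borel (S a) borel (block a n)"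
proof -
  have "indep_var borel (\<lambda>\<omega>. (\<lambda>x. \<Sum>i<a. x i) (\<lambda>i\<in>{..<a}. Y i \<omega>))
      borel (\<lambda>\<omega>. (\<lambda>x. \<Sum>i\<in>{a..<a + n}. x i) (\<lambda>i\<in>{a..<a + n}. Y i \<omega>))"
    by (rule indep_var_blocks) auto
  then show ?thesis by (simp add: block_def[abs_def] S_def[abs_def])
qed

text \<open>Adding one variable convolves with the law of \<open>Y 0\<close>, wherever the block
  starts; induction on the length does the rest.\<close>

lemma distr_block: "distr M borel (block a n) = distr M borel (S n)"
proof -
  have "distr M borel (block a n) = distr M borel (block b n)" for b
  proof (induction n)
    case 0
    then show ?case by (simp add: block_def[abs_def])
  next
    case (Suc n)
    have "distr M borel (block c (Suc n)) = convolution (distr M borel (block c n)) (distr M borel (Y 0))" for c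
      using sum_indep_random_variable[OF indep_var_block_next[of c n]] ident[of "c + n"]
      by (simp add: block_def[abs_def])
    then show ?case using Suc by simp
  qed
  also have "block 0 n = S n"
    by (simp add: block_def[abs_def] S_def[abs_def] lessThan_atLeast0)
  finally show ?thesis .
qed

lemma prob_block: "prob (block a n -` {b..} \<inter> space M) = prob (S n -` {b..} \<inter> space M)"
  using distr_block[of a n] by (simp flip: measure_distr[of _ M borel])

text \<open>If each of \<open>m\<close> consecutive stretches of length \<open>n\<close> gains at
  least \<open>b\<close>, the whole gains at least \<open>m * b\<close>, and the stretches are
  independent.\<close>

lemma prob_S_mult_ge:
  "prob (S n -` {b..} \<inter> space M) ^ m \<le> prob (S (m * n) -` {real m * b..} \<inter> space M)"
proof (induction m)
  case 0
  have "S 0 -` {0..} \<inter> space M = space M" by auto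
  then show ?case by (simp add: prob_space)
next
  case (Suc m)
  let ?U = "block (m * n) n"
  have "prob (S n -` {b..} \<inter> space M) ^ Suc m \<le>
      prob (S (m * n) -` {real m * b..} \<inter> space M) * prob (?U -` {b..} \<inter> space M)"
    using Suc by (simp add: prob_block mult.commute mult_left_mono)
  also have "\<dots> = prob ((\<lambda>\<omega>. (S (m * n) \<omega>, ?U \<omega>)) -` ({real m * b..} \<times> {b..}) \<inter> space M)"
    by (rule indep_varD[OF indep_var_S_block, symmetric]) auto
  also have "\<dots> \<le> prob (S (Suc m * n) -` {real (Suc m) * b..} \<inter> space M)"
  proof (intro finite_measure_mono)
    show "(\<lambda>\<omega>. (S (m * n) \<omega>, ?U \<omega>)) -` ({real m * b..} \<times> {b..}) \<inter> space M
      \<subseteq> S (Suc m * n) -` {real (Suc m) * b..} \<inter> space M"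
      using S_add[of "m * n" n] by (auto simp: algebra_simps)
  qed simp
  finally show ?case .
qed

text \<open>The extra factor 2 leaves strict room below the Gaussian tail, so convergence of the
  distribution functions at \<open>a\<close>, which is no atom, gives the bound for all large
  \<open>n\<close>.\<close>

lemma S_tail_lower:
  assumes a: "a \<ge> 0"
  shows "\<forall>\<^sub>F n in sequentially.
    exp (- (a + 1)\<^sup>2 / 2) / (2 * sqrt (2 * pi)) \<le> prob (S n -` {a * sqrt (s * real n)..} \<inter> space M)"
proof -
  define D where "D = (\<lambda>n. distr M borel (\<lambda>\<omega>. S n \<omega> / sqrt (real n * s)))"
  have "weak_conv_m (\<lambda>n. distr M borel (\<lambda>x. (\<Sum>i<n. Y i x) / sqrt (real n * (sqrt s)\<^sup>2))) std_normal_distribution"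
    using s_pos by (intro central_limit_theorem_zero_mean[where \<mu> = "distr M borel (Y 0)"])
      (use indep ident integrable_Y expectation_Y in auto)
  then have conv: "weak_conv_m D std_normal_distribution"
    using s_pos by (simp add: D_def S_def)
  interpret N: real_distribution std_normal_distribution by (rule real_dist_normal_dist)
  have "emeasure std_normal_distribution {a} = 0"
    by (simp add: emeasure_density nn_integral_0_iff_AE AE_lborel_singleton
        split: split_indicator)
  then have "isCont (cdf std_normal_distribution) a"
    by (simp add: N.isCont_cdf measure_def)
  then have "(\<lambda>n. cdf (D n) a) \<longlonglongrightarrow> cdf std_normal_distribution a"
    using conv by (simp add: weak_conv_m_def weak_conv_def)
  then have "(\<lambda>n. 1 - cdf (D n) a) \<longlonglongrightarrow> 1 - cdf std_normal_distribution a"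
    by (intro tendsto_intros)
  moreover have "exp (- (a + 1)\<^sup>2 / 2) / (2 * sqrt (2 * pi)) < 1 - cdf std_normal_distribution a"
    by (rule less_le_trans[OF _ std_normal_tail_lower[OF a]]) (simp add: divide_strict_left_mono)
  ultimately have "\<forall>\<^sub>F n in sequentially. exp (- (a + 1)\<^sup>2 / 2) / (2 * sqrt (2 * pi)) < 1 - cdf (D n) a"
    by (rule order_tendstoD)
  then show ?thesis using eventually_gt_at_top[of 0]
  proof eventually_elim
    case (elim n)
    have "cdf (D n) a = prob {\<omega> \<in> space M. S n \<omega> / sqrt (real n * s) \<le> a}"
      unfolding D_def cdf_def by (subst measure_distr) (auto intro!: arg_cong[where f = prob])
    then have "1 - cdf (D n) a = prob (space M - {\<omega> \<in> space M. S n \<omega> / sqrt (real n * s) \<le> a})"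
      by (subst prob_compl) auto
    also have "\<dots> \<le> prob (S n -` {a * sqrt (s * real n)..} \<inter> space M)"
      using s_pos elim by (intro finite_measure_mono) (auto simp: field_simps)
    finally show ?case using elim by simp
  qed
qed

text \<open>For large \<open>a\<close> the surplus \<open>(D - 1) * a\<^sup>2 / 2\<close> absorbs
  the linear term of \<open>(a + 1)\<^sup>2 / 2\<close> and the constant prefactor. This
  \<open>a\<close> is fixed before \<open>n\<close> grows.\<close>

lemma S_tail_lower_sharp:
  assumes D: "D > 1"
  obtains a where "a > 0"
    "\<forall>\<^sub>F n in sequentially. exp (- D * a\<^sup>2 / 2) \<le> prob (S n -` {a * sqrt (s * real n)..} \<inter> space M)"
proof -
  define e where "e = D - 1"
  have e: "e > 0" using D by (simp add: e_def)
  have "filterlim (\<lambda>a::real. e * a\<^sup>2 / 2 - a - 1 / 2) at_top at_top"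
    using e by real_asymp
  then have "\<forall>\<^sub>F a::real in at_top. e * a\<^sup>2 / 2 - a - 1 / 2 \<ge> ln (2 * sqrt (2 * pi)) \<and> a > 0"
    by (intro eventually_conj eventually_gt_at_top) (simp add: filterlim_at_top)
  then obtain a :: real where a: "e * a\<^sup>2 / 2 - a - 1 / 2 \<ge> ln (2 * sqrt (2 * pi))" "a > 0"
    using eventually_happens'[OF trivial_limit_at_top_linorder] by blast
  have "exp (- D * a\<^sup>2 / 2) \<le> exp (- (a + 1)\<^sup>2 / 2 - ln (2 * sqrt (2 * pi)))"
    using a by (simp add: e_def power2_eq_square algebra_simps)
  also have "\<dots> = exp (- (a + 1)\<^sup>2 / 2) / (2 * sqrt (2 * pi))"
    by (simp add: exp_diff)
  finally have le: "exp (- D * a\<^sup>2 / 2) \<le> exp (- (a + 1)\<^sup>2 / 2) / (2 * sqrt (2 * pi))" .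
  show thesis
  proof (rule that[OF a(2)])
    show "\<forall>\<^sub>F n in sequentially. exp (- D * a\<^sup>2 / 2) \<le> prob (S n -` {a * sqrt (s * real n)..} \<inter> space M)"
      using S_tail_lower[OF less_imp_le[OF a(2)]]
      by (rule eventually_mono) (rule order_trans[OF le])
  qed
qed

end

text \<open>The range is the one in which the end of the \<open>k\<close>-th block lies. The
  estimate comes from \<open>fact (Suc k) \<le> (k + 1) ^ Suc k\<close>; the lower bound on
  \<open>x\<close> makes \<open>ln x\<close> positive, so that the outer logarithm is
  monotone.\<close>

lemma ln_ln_fact_le:
  assumes "k \<ge> 2" "fact k \<le> x" "x \<le> fact (Suc k) ^ 4"
  shows "ln (ln x) \<le> ln (4 * (real k + 1) * ln (real k + 1))"
proof -
  have "(2::real) \<le> fact k" using fact_mono[OF assms(1), where ?'a = real] by (simp add: fact_2)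
  then have x: "x > 1" using assms(2) by linarith
  have "(fact (Suc k) :: real) \<le> (real k + 1) ^ Suc k"
    using fact_le_power[of "Suc k", where ?'a = real] by (simp only: of_nat_power of_nat_Suc add.commute)
  then have "x \<le> ((real k + 1) ^ Suc k) ^ 4"
    using assms(3) power_mono[of "fact (Suc k) :: real" _ 4] by (meson fact_ge_zero order_trans)
  then have "ln x \<le> ln (((real k + 1) ^ Suc k) ^ 4)" using x by (intro ln_mono) auto
  also have "\<dots> = 4 * (real k + 1) * ln (real k + 1)"
    by (simp add: ln_realpow del: power_Suc)
  finally show ?thesis using x by (intro ln_mono) auto
qed

text \<open>In the lower bound, \<open>u k\<close> is the number of sub-blocks of the \<open>k\<close>-th block and the left-hand side
  is the target value at the end of that block, both divided by the square root of the variance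
  accumulated before the block.\<close>

lemma lil_lower_growth:
  fixes u :: "nat \<Rightarrow> real" and a \<gamma> \<theta> :: real
  assumes u: "(\<lambda>k. u k / ln (real k)) \<longlonglongrightarrow> \<theta>" and \<theta>: "\<theta> > 0" and a: "a > 0"
    and \<gamma>: "0 < \<gamma>" "2 * \<gamma>\<^sup>2 < \<theta> * a\<^sup>2"
  shows "\<forall>\<^sub>F k in sequentially. \<gamma> * sqrt (2 * ((1 + u k * (real k)\<^sup>2) * ln (4 * (real k + 1) * ln (real k + 1))))
    \<le> (u k * a - 1) * real k"
proof -
  define L where "L = (\<lambda>k. ln (4 * (real k + 1) * ln (real k + 1)))"
  \<comment> \<open>The squared ratio of the two sides, with powers of \<open>ln (real k)\<close>
    divided out so that every factor converges. The limit is
    \<open>2 * \<gamma>\<^sup>2 / (\<theta> * a\<^sup>2)\<close>, below 1 by assumption.\<close>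
  define R where "R = (\<lambda>k. \<gamma>\<^sup>2 * 2 * ((1 / ((real k)\<^sup>2 * ln (real k)) + u k / ln (real k)) * (L k / ln (real k)))
    / (u k / ln (real k) * a - 1 / ln (real k))\<^sup>2)"
  have L: "(\<lambda>k. L k / ln (real k)) \<longlonglongrightarrow> 1" unfolding L_def by real_asymp
  have 1: "(\<lambda>k. 1 / ((real k)\<^sup>2 * ln (real k))) \<longlonglongrightarrow> 0" "(\<lambda>k. 1 / ln (real k)) \<longlonglongrightarrow> 0"
    by real_asymp+
  have "R \<longlonglongrightarrow> \<gamma>\<^sup>2 * 2 * ((0 + \<theta>) * 1) / (\<theta> * a - 0)\<^sup>2"
    unfolding R_def using \<theta> a by (intro tendsto_intros L 1 u) auto
  moreover have "\<gamma>\<^sup>2 * 2 * ((0 + \<theta>) * 1) / (\<theta> * a - 0)\<^sup>2 < 1"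
    using \<theta> a \<gamma> by (simp add: power2_eq_square field_simps)
  ultimately have R: "\<forall>\<^sub>F k in sequentially. R k < 1" by (rule order_tendstoD)
  have "(\<lambda>k. u k / ln (real k) * a - 1 / ln (real k)) \<longlonglongrightarrow> \<theta> * a - 0"
    by (intro tendsto_intros 1 u)
  then have pos: "\<forall>\<^sub>F k in sequentially. u k / ln (real k) * a - 1 / ln (real k) > 0"
    by (rule order_tendstoD(1)) (use \<theta> a in simp)
  show ?thesis using R pos eventually_gt_at_top[of 1]
  proof eventually_elim
    case (elim k)
    have l: "ln (real k) > 0" using elim by simp
    define v where "v = u k * a - 1"
    have v: "v > 0" "u k / ln (real k) * a - 1 / ln (real k) = v / ln (real k)"
      using elim l by (auto simp: v_def diff_divide_distrib[symmetric] zero_less_divide_iff)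
    have "R k = \<gamma>\<^sup>2 * 2 * ((1 + u k * (real k)\<^sup>2) * L k) / (v * real k)\<^sup>2"
      unfolding R_def v(2) using l v(1) elim by (simp add: field_simps power2_eq_square)
    with elim have "\<gamma>\<^sup>2 * 2 * ((1 + u k * (real k)\<^sup>2) * L k) / (v * real k)\<^sup>2 \<le> 1" by simp
    moreover have "(v * real k)\<^sup>2 > 0" using v elim by simp
    ultimately have "\<gamma>\<^sup>2 * (2 * ((1 + u k * (real k)\<^sup>2) * L k)) \<le> (v * real k)\<^sup>2"
      by (simp only: divide_le_eq_1_pos mult.assoc)
    then have "sqrt (\<gamma>\<^sup>2 * (2 * ((1 + u k * (real k)\<^sup>2) * L k))) \<le> v * real k"
      using v by (intro real_le_lsqrt) auto
    then show ?case using \<gamma> by (simp add: real_sqrt_mult v_def L_def)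
  qed
qed

context iid_exp_moment begin

lemma lil_lower:
  assumes \<eta>: "0 < \<eta>" "\<eta> < 1"
  shows "AE \<omega> in M. \<exists>\<^sub>\<infinity>n. S n \<omega> \<ge> (1 - \<eta>) * sqrt (2 * s * (real n * ln (ln (real n))))"
proof -
  \<comment> \<open>Half of \<eta> pays for \<open>D > 1\<close>, the other half gives the strict
    inequality \<open>2 * (1 - \<eta>)\<^sup>2 < 2 / D\<close> that the growth lemma needs.\<close>
  define D where "D = 1 / (1 - \<eta> / 2)\<^sup>2"
  have "(1 - \<eta> / 2)\<^sup>2 < 1" using \<eta> by (simp add: power_less_one_iff)
  then have D: "D > 1" using \<eta> unfolding D_def by (simp add: less_divide_eq_1)
  obtain a where a: "a > 0" and tail:
    "\<forall>\<^sub>F n in sequentially. exp (- D * a\<^sup>2 / 2) \<le> prob (S n -` {a * sqrt (s * real n)..} \<inter> space M)"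
    using S_tail_lower_sharp[OF D] by blast
  then obtain n0 where n0: "\<And>n. n \<ge> n0 \<Longrightarrow>
      exp (- D * a\<^sup>2 / 2) \<le> prob (S n -` {a * sqrt (s * real n)..} \<inter> space M)"
    by (auto simp: eventually_sequentially)
  \<comment> \<open>The rate at which \<open>exp (- D * a\<^sup>2 / 2)\<close> to the power
    \<open>\<theta> * ln k\<close> equals exactly \<open>1 / k\<close>.\<close>
  define \<theta> where "\<theta> = 2 / (D * a\<^sup>2)"
  have \<theta>: "\<theta> > 0" using a D by (simp add: \<theta>_def)
  \<comment> \<open>The \<open>k\<close>-th block is \<open>{N k..<T k}\<close>, cut into \<open>m k\<close> sub-blocks of length \<open>l k\<close>. A deviation of
    \<open>a\<close> standard deviations on every sub-block has probability at least \<open>1 / k\<close>, and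
    \<open>N k / l k = 1 / k\<^sup>2\<close> makes the sum before the block negligible.\<close>
  define m where "m = (\<lambda>k. nat \<lfloor>\<theta> * ln (real k)\<rfloor>)"
  define N where "N = (\<lambda>k. fact k ^ 4 :: nat)"
  define l where "l = (\<lambda>k. k\<^sup>2 * N k)"
  define T where "T = (\<lambda>k. N k + m k * l k)"
  have m_bounds: "real (m k) \<le> \<theta> * ln (real k)" "real (m k) > \<theta> * ln (real k) - 1" if "k \<ge> 1" for k
  proof -
    have "\<theta> * ln (real k) \<ge> 0" using that \<theta> by simp
    then show "real (m k) \<le> \<theta> * ln (real k)" "real (m k) > \<theta> * ln (real k) - 1"
      unfolding m_def by linarith+
  qed
  have m_lim: "(\<lambda>k. real (m k) / ln (real k)) \<longlonglongrightarrow> \<theta>"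
  proof (rule tendsto_sandwich)
    show "(\<lambda>k. \<theta> - 1 / ln (real k)) \<longlonglongrightarrow> \<theta>" by real_asymp
    show "\<forall>\<^sub>F k in sequentially. \<theta> - 1 / ln (real k) \<le> real (m k) / ln (real k)"
      using eventually_gt_at_top[of 1]
    proof eventually_elim
      case (elim k)
      then have "(\<theta> * ln (real k) - 1) / ln (real k) \<le> real (m k) / ln (real k)"
        using m_bounds(2)[of k] by (intro divide_right_mono) auto
      then show ?case using elim by (simp add: diff_divide_distrib)
    qed
    show "\<forall>\<^sub>F k in sequentially. real (m k) / ln (real k) \<le> \<theta>"
      using eventually_gt_at_top[of 1]
      by eventually_elim (use m_bounds(1) in \<open>simp add: divide_le_eq\<close>)
  qed simp
  have "2 * (1 - \<eta>)\<^sup>2 < \<theta> * a\<^sup>2"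
  proof -
    have "(1 - \<eta>)\<^sup>2 < (1 - \<eta> / 2)\<^sup>2" using \<eta> by (intro power_strict_mono) auto
    then show ?thesis using a by (simp add: \<theta>_def D_def)
  qed
  then have growth: "\<forall>\<^sub>F k in sequentially. (1 - \<eta>) *
      sqrt (2 * ((1 + real (m k) * (real k)\<^sup>2) * ln (4 * (real k + 1) * ln (real k + 1))))
      \<le> (real (m k) * a - 1) * real k"
    using \<eta> by (intro lil_lower_growth[OF m_lim \<theta> a]) auto
  have "\<forall>\<^sub>F k in sequentially. \<theta> * ln (real k) \<le> real k" by real_asymp
  then have "\<forall>\<^sub>F k in sequentially. m k \<le> k"
    using eventually_ge_at_top[of 1]
    by eventually_elim (use m_bounds(1) of_nat_le_iff order_trans in blast)
  then have "\<forall>\<^sub>F k in sequentially. m k \<le> k \<and> k \<ge> n0 \<and> k \<ge> 2 \<and> (1 - \<eta>) *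
      sqrt (2 * ((1 + real (m k) * (real k)\<^sup>2) * ln (4 * (real k + 1) * ln (real k + 1))))
      \<le> (real (m k) * a - 1) * real k"
    using growth by (intro eventually_conj eventually_ge_at_top)
  then obtain k0 where k0: "\<And>k. k \<ge> k0 \<Longrightarrow> m k \<le> k \<and> k \<ge> n0 \<and> k \<ge> 2 \<and> (1 - \<eta>) *
      sqrt (2 * ((1 + real (m k) * (real k)\<^sup>2) * ln (4 * (real k + 1) * ln (real k + 1))))
      \<le> (real (m k) * a - 1) * real k"
    by (auto simp: eventually_sequentially)
  have N_ge: "k \<le> N k" "fact k \<le> N k" "N k > 0" for k
  proof -
    show "fact k \<le> N k" using power_increasing[of 1 4 "fact k :: nat"] by (simp add: N_def fact_ge_1)
    then show "k \<le> N k" using fact_ge_self[of k] by linarith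
  qed (simp add: N_def)
  \<comment> \<open>The fourth power in \<open>N\<close> serves here: successive values grow by
    \<open>Suc k ^ 4\<close>, which leaves room for \<open>m k \<le> k\<close> sub-blocks of length
    \<open>k\<^sup>2 * N k\<close>.\<close>
  have T_le: "T k \<le> N (Suc k)" if "k \<ge> k0" for k
  proof -
    have "1 + m k * k\<^sup>2 \<le> 1 + k * k\<^sup>2" using k0[OF that] by simp
    also have "\<dots> \<le> Suc k ^ 4" by (simp add: eval_nat_numeral algebra_simps)
    finally have "N k * (1 + m k * k\<^sup>2) \<le> N k * Suc k ^ 4" by (rule mult_left_mono) simp
    also have "\<dots> = N (Suc k)" unfolding N_def fact_Suc by (simp only: power_mult_distrib of_nat_id mult.commute)
    finally show ?thesis by (simp add: T_def l_def algebra_simps)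
  qed
  have N_mono: "N i \<le> N j" if "i \<le> j" for i j
    unfolding N_def using that by (intro power_mono fact_mono) auto

  \<comment> \<open>The shift by \<open>k0\<close> makes the blocks disjoint for every index
    \<open>j\<close>, since \<open>T_le\<close> starts at \<open>k0\<close>.\<close>
  define Z where "Z = (\<lambda>j. block (N (j + k0)) (m (j + k0) * l (j + k0)))"
  define A where "A = (\<lambda>j. {real (m (j + k0)) * (a * sqrt (s * real (l (j + k0))))..})"
  have "AE \<omega> in M. \<exists>\<^sub>\<infinity>j. Z j \<omega> \<in> A j"
  proof (rule borel_cantelli_indep_vars)
    define K where "K = (\<lambda>j. {N (j + k0)..<T (j + k0)})"
    have "disjoint_family K"
    proof -
      have "K i \<inter> K j = {}" if "i < j" for i j
        using T_le[of "i + k0"] N_mono[of "Suc (i + k0)" "j + k0"] that by (auto simp: K_def)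
      then show ?thesis unfolding disjoint_family_on_def
        by (metis Int_commute nat_neq_iff)
    qed
    then have "indep_vars (\<lambda>j. PiM (K j) (\<lambda>_. borel)) (\<lambda>j \<omega>. \<lambda>i\<in>K j. Y i \<omega>) UNIV"
      by (intro indep_vars_restrict[OF indep]) auto
    then have "indep_vars (\<lambda>_. borel) (\<lambda>j \<omega>. (\<lambda>x. \<Sum>i\<in>K j. x i) (\<lambda>i\<in>K j. Y i \<omega>) :: real) UNIV"
      by (rule indep_vars_compose2) measurable
    then show "indep_vars (\<lambda>_. borel) Z UNIV"
      by (simp add: Z_def block_def[abs_def] K_def T_def)
    show "A k \<in> sets borel" for k by (simp add: A_def)
    show "\<not> summable (\<lambda>j. prob (Z j -` A j \<inter> space M))"
    proof
      assume summable: "summable (\<lambda>j. prob (Z j -` A j \<inter> space M))"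
      have "inverse (real (j + k0)) \<le> prob (Z j -` A j \<inter> space M)" for j
      proof -
        define k where "k = j + k0"
        have k: "k \<ge> k0" "k \<ge> 2" using k0[of k] by (auto simp: k_def)
        have "l k \<ge> n0"
        proof -
          have "N k \<le> l k" using k by (simp add: l_def)
          then show ?thesis using N_ge(1)[of k] k0[OF k(1)] by linarith
        qed
        have "inverse (real k) = exp (- ln (real k))" using k by (simp add: exp_minus)
        also have "\<dots> \<le> exp (real (m k) * (- D * a\<^sup>2 / 2))"
        proof -
          have "real (m k) * (D * a\<^sup>2 / 2) \<le> \<theta> * ln (real k) * (D * a\<^sup>2 / 2)"
            using m_bounds(1)[of k] k D by (intro mult_right_mono) auto
          also have "\<dots> = ln (real k)" using a D by (simp add: \<theta>_def)
          finally show ?thesis by simp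
        qed
        also have "\<dots> = exp (- D * a\<^sup>2 / 2) ^ m k" by (rule exp_of_nat_mult)
        also have "\<dots> \<le> prob (S (l k) -` {a * sqrt (s * real (l k))..} \<inter> space M) ^ m k"
          by (intro power_mono n0 \<open>l k \<ge> n0\<close>) simp
        also have "\<dots> \<le> prob (Z j -` A j \<inter> space M)"
          unfolding Z_def A_def k_def[symmetric] prob_block by (rule prob_S_mult_ge)
        finally show ?thesis by (simp add: k_def)
      qed
      then have "summable (\<lambda>j. inverse (real (j + k0)))"
        by (intro summable_comparison_test'[OF summable, of 0]) auto
      then have "summable (\<lambda>j. inverse (real j))"
        by (subst (asm) summable_iff_shift)
      then show False using not_summable_harmonic[where ?'a = real] by simp
    qed
  qed
  \<comment> \<open>The sum before the block is eventually below one standard deviation of a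
    sub-block; this loss is the \<open>- 1\<close> in \<open>growth\<close>.\<close>
  moreover have "AE \<omega> in M. \<forall>\<^sub>F k in sequentially.
      \<omega> \<in> space M - {\<omega> \<in> space M. \<bar>S (N k) \<omega>\<bar> \<ge> sqrt (s * real (l k))}"
  proof (rule borel_cantelli_AE1)
    have "prob {\<omega> \<in> space M. \<bar>S (N k) \<omega>\<bar> \<ge> sqrt (s * real (l k))} \<le> 1 / (real k)\<^sup>2" if "k \<ge> 1" for k
    proof -
      have "l k > 0" using that N_ge(3)[of k] by (simp add: l_def)
      then have "prob {\<omega> \<in> space M. \<bar>S (N k) \<omega>\<bar> \<ge> sqrt (s * real (l k))}
          \<le> real (N k) * s / (sqrt (s * real (l k)))\<^sup>2"
        using s_pos by (intro S_Chebyshev) auto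
      also have "\<dots> = 1 / (real k)\<^sup>2"
        using s_pos N_ge(3)[of k] that by (simp add: l_def)
      finally show ?thesis .
    qed
    moreover have summable: "summable (\<lambda>k. 1 / (real k)\<^sup>2)"
      using inverse_power_summable[of 2, where ?'a = real] by (simp add: inverse_eq_divide)
    ultimately show "summable (\<lambda>k. prob {\<omega> \<in> space M. \<bar>S (N k) \<omega>\<bar> \<ge> sqrt (s * real (l k))})"
      by (intro summable_comparison_test'[OF summable, of 1]) auto
  qed (auto simp: less_top[symmetric])
  ultimately show ?thesis
  proof eventually_elim
    case (elim \<omega>)
    from elim(2) obtain k1 where k1: "\<And>k. k \<ge> k1 \<Longrightarrow> \<bar>S (N k) \<omega>\<bar> < sqrt (s * real (l k))"
      by (auto simp: eventually_sequentially not_le)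
    show ?case
      unfolding INFM_nat_le
    proof
      fix n
      obtain j where j: "j \<ge> max n k1" "Z j \<omega> \<in> A j"
        using elim(1) unfolding INFM_nat_le by blast
      define k where "k = j + k0"
      have k: "k \<ge> k0" "k \<ge> n" "k \<ge> k1" using j(1) by (auto simp: k_def)
      note k' = k0[OF k(1)]
      define r where "r = sqrt (s * real (N k))"
      have r: "r > 0" using s_pos N_ge(3)[of k] by (simp add: r_def)
      have rl: "sqrt (s * real (l k)) = real k * r"
        by (simp add: r_def l_def real_sqrt_mult)
      have "T k \<ge> n" using N_ge(1)[of k] k by (simp add: T_def)
      moreover have "(1 - \<eta>) * sqrt (2 * s * (real (T k) * ln (ln (real (T k))))) \<le> S (T k) \<omega>"
      proof -
        have "real (T k) \<le> real (N (Suc k))" using T_le[OF k(1)] by simp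
        then have "real (T k) \<le> fact (Suc k) ^ 4" unfolding N_def by (simp only: of_nat_power of_nat_fact)
        moreover have "fact k \<le> real (T k)"
        proof -
          have "fact k \<le> T k" using N_ge(2)[of k] by (simp add: T_def)
          then show ?thesis by (metis of_nat_fact of_nat_le_iff)
        qed
        ultimately have lnln: "ln (ln (real (T k))) \<le> ln (4 * (real k + 1) * ln (real k + 1))"
          using k' by (intro ln_ln_fact_le) auto
        have T: "real (T k) = real (N k) * (1 + real (m k) * (real k)\<^sup>2)"
          by (simp add: T_def l_def algebra_simps)
        have "(1 - \<eta>) * sqrt (2 * s * (real (T k) * ln (ln (real (T k)))))
            \<le> (1 - \<eta>) * sqrt (2 * s * (real (T k) * ln (4 * (real k + 1) * ln (real k + 1))))"
          using \<eta> s_pos lnln by (intro mult_left_mono real_sqrt_le_mono) auto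
        also have "\<dots> = r * ((1 - \<eta>) *
            sqrt (2 * ((1 + real (m k) * (real k)\<^sup>2) * ln (4 * (real k + 1) * ln (real k + 1)))))"
          unfolding T r_def by (simp add: real_sqrt_mult)
        also have "\<dots> \<le> r * ((real (m k) * a - 1) * real k)"
          using k' r by (intro mult_left_mono) auto
        also have "\<dots> = real (m k) * (a * sqrt (s * real (l k))) - sqrt (s * real (l k))"
          unfolding rl by (simp add: algebra_simps)
        also have "\<dots> \<le> Z j \<omega> + S (N k) \<omega>"
          using j(2) k1[OF k(3)] by (simp add: A_def k_def)
        also have "\<dots> = S (T k) \<omega>"
          by (simp add: Z_def T_def S_add k_def)
        finally show ?thesis .
      qed
      ultimately show "\<exists>n'\<ge>n. (1 - \<eta>) * sqrt (2 * s * (real n' * ln (ln (real n')))) \<le> S n' \<omega>"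
        by blast
    qed
  qed
qed

end

section \<open>The sine product\<close>

context prob_space begin

context
  fixes X :: "'a \<Rightarrow> real"
  assumes X [measurable]: "random_variable borel X"
    and uniform: "distr M borel X = uniform_measure lborel {0..1}"
begin

lemma uniform_AE_interior: "AE \<omega> in M. 0 < X \<omega> \<and> X \<omega> < 1"
proof -
  have "AE x in lborel. x \<in> {0..1::real} \<longrightarrow> 0 < x \<and> x < 1"
    using AE_lborel_singleton[of "0::real"] AE_lborel_singleton[of "1::real"]
    by eventually_elim auto
  then have "AE x in uniform_measure lborel {0..1::real}. 0 < x \<and> x < 1"
    by (subst AE_uniform_measure) auto
  then show ?thesis
    by (subst (asm) uniform[symmetric], subst (asm) AE_distr_iff) auto
qed

lemma sin_uniform_pos: "AE \<omega> in M. sin (pi * X \<omega>) > 0"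
  using uniform_AE_interior by eventually_elim (auto intro!: sin_gt_zero)

lemma log_sine_mgf:
  assumes t: "t > -1"
  shows "integrable M (\<lambda>\<omega>. exp (t * ln (2 * sin (pi * X \<omega>))))"
    and "expectation (\<lambda>\<omega>. exp (t * ln (2 * sin (pi * X \<omega>)))) = Gamma (1 + t) / (Gamma (1 + t / 2))\<^sup>2"
proof -
  have "(\<integral>\<^sup>+\<omega>. ennreal (exp (t * ln (2 * sin (pi * X \<omega>)))) \<partial>M) =
      (\<integral>\<^sup>+\<omega>. ennreal ((2 * sin (pi * X \<omega>)) powr t) \<partial>M)"
    using sin_uniform_pos by (intro nn_integral_cong_AE) (auto simp: powr_def)
  also have "\<dots> = (\<integral>\<^sup>+x. ennreal ((2 * sin (pi * x)) powr t) \<partial>distr M borel X)"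
    by (subst nn_integral_distr) auto
  also have "\<dots> = (\<integral>\<^sup>+x\<in>{0..1}. ennreal ((2 * sin (pi * x)) powr t) \<partial>lborel)"
    unfolding uniform by (subst nn_integral_uniform_measure) (auto simp: divide_ennreal_def)
  also have "\<dots> = ennreal (Gamma (1 + t) / (Gamma (1 + t / 2))\<^sup>2)"
    by (rule nn_integral_sine_powr[OF t])
  finally have "(\<integral>\<^sup>+\<omega>. ennreal (exp (t * ln (2 * sin (pi * X \<omega>)))) \<partial>M) =
      ennreal (Gamma (1 + t) / (Gamma (1 + t / 2))\<^sup>2)" .
  moreover have "0 \<le> Gamma (1 + t) / (Gamma (1 + t / 2))\<^sup>2"
    using t by (intro divide_nonneg_nonneg) auto
  ultimately have "integrable M (\<lambda>\<omega>. exp (t * ln (2 * sin (pi * X \<omega>)))) \<and>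
      expectation (\<lambda>\<omega>. exp (t * ln (2 * sin (pi * X \<omega>)))) = Gamma (1 + t) / (Gamma (1 + t / 2))\<^sup>2"
    by (subst (asm) nn_integral_eq_integrable) auto
  then show "integrable M (\<lambda>\<omega>. exp (t * ln (2 * sin (pi * X \<omega>))))"
    "expectation (\<lambda>\<omega>. exp (t * ln (2 * sin (pi * X \<omega>)))) = Gamma (1 + t) / (Gamma (1 + t / 2))\<^sup>2"
    by auto
qed

text \<open>\<open>exp (\<bar>y\<bar> / 2)\<close> is at most
  \<open>exp (y / 2) + exp (- y / 2)\<close>, and both exponents, 1/2 and -1/2, lie in the range
  \<open>t > -1\<close> of the Beta integral.\<close>

lemma log_sine_exp_abs: "integrable M (\<lambda>\<omega>. exp (1 / 2 * \<bar>ln (2 * sin (pi * X \<omega>))\<bar>))"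
proof (rule Bochner_Integration.integrable_bound)
  show "integrable M (\<lambda>\<omega>. exp (1 / 2 * ln (2 * sin (pi * X \<omega>))) + exp (- 1 / 2 * ln (2 * sin (pi * X \<omega>))))"
    by (intro Bochner_Integration.integrable_add log_sine_mgf) auto
  have "exp (1 / 2 * \<bar>y\<bar>) \<le> \<bar>exp (1 / 2 * y) + exp (- 1 / 2 * y)\<bar>" for y :: real
    by (cases "y \<ge> 0") auto
  then show "AE \<omega> in M. norm (exp (1 / 2 * \<bar>ln (2 * sin (pi * X \<omega>))\<bar>))
      \<le> norm (exp (1 / 2 * ln (2 * sin (pi * X \<omega>))) + exp (- 1 / 2 * ln (2 * sin (pi * X \<omega>))))"
    unfolding real_norm_def abs_exp_cancel by (intro AE_I2)
qed measurable

lemma log_sine_moments: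
  "expectation (\<lambda>\<omega>. ln (2 * sin (pi * X \<omega>))) = 0"
  "expectation (\<lambda>\<omega>. (ln (2 * sin (pi * X \<omega>)))\<^sup>2) = pi\<^sup>2 / 12"
proof -
  have "((\<lambda>t. (expectation (\<lambda>\<omega>. exp (t * ln (2 * sin (pi * X \<omega>)))) - 1) / t\<^sup>2) \<longlongrightarrow> pi\<^sup>2 / 24) (at_right 0)"
    by (rule Lim_transform_eventually[OF Gamma_ratio_second_order])
      (use eventually_at_right_less[of "0::real"] in
        \<open>auto elim!: eventually_mono simp: log_sine_mgf(2)\<close>)
  from moments_from_mgf[OF _ _ log_sine_exp_abs this]
  show "expectation (\<lambda>\<omega>. ln (2 * sin (pi * X \<omega>))) = 0"
    "expectation (\<lambda>\<omega>. (ln (2 * sin (pi * X \<omega>)))\<^sup>2) = pi\<^sup>2 / 12"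
    by auto
qed

end

end

theorem theorem6:
  fixes M :: "'a measure" and X :: "nat \<Rightarrow> 'a \<Rightarrow> real" and \<epsilon> :: real
  assumes "prob_space M"
    and "prob_space.indep_vars M (\<lambda>_. borel) X {1..}"
    and "\<And>k. k \<ge> 1 \<Longrightarrow> distr M borel (X k) = uniform_measure lborel {0..1}"
    and "\<epsilon> > 0"
  shows "AE \<omega> in M.
      (\<forall>\<^sub>F N in sequentially.
         sine_prod X N \<omega>
           \<le> exp ((pi / sqrt 6 + \<epsilon>) * sqrt (real N * ln (ln (real N))))) \<and>
      (\<exists>\<^sub>\<infinity>N.
         sine_prod X N \<omega>
           \<ge> exp ((pi / sqrt 6 - \<epsilon>) * sqrt (real N * ln (ln (real N)))))"
proof -
  interpret prob_space M by fact
  note indep = assms(2) and uniform = assms(3)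
  have X [measurable]: "X k \<in> borel_measurable M" if "k \<ge> 1" for k
    using indep that by (auto simp: indep_vars_def)
  define Y where "Y = (\<lambda>i \<omega>. ln (2 * sin (pi * X (Suc i) \<omega>)))"
  interpret Y: iid_exp_moment M Y "pi\<^sup>2 / 12" "1 / 2"
  proof
    \<comment> \<open>Restricting to the disjoint singletons \<open>{Suc j}\<close> moves the
      independence from the index set \<open>{1..}\<close> to all naturals.\<close>
    have "indep_vars (\<lambda>j. PiM {Suc j} (\<lambda>_. borel)) (\<lambda>j \<omega>. \<lambda>i\<in>{Suc j}. X i \<omega>) UNIV"
      by (rule indep_vars_restrict[OF indep]) (auto simp: disjoint_family_on_def)
    then have "indep_vars (\<lambda>_. borel) (\<lambda>j \<omega>. (\<lambda>x. ln (2 * sin (pi * x (Suc j)))) (\<lambda>i\<in>{Suc j}. X i \<omega>)) UNIV"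
      by (rule indep_vars_compose2) measurable
    then show "indep_vars (\<lambda>_. borel) Y UNIV" by (simp add: Y_def)
    have "distr M borel (Y i) = distr (uniform_measure lborel {0..1}) borel (\<lambda>x. ln (2 * sin (pi * x)))" for i
      unfolding uniform[of "Suc i", simplified, symmetric]
      by (subst distr_distr) (auto simp: Y_def o_def)
    then show "distr M borel (Y i) = distr M borel (Y 0)" for i by simp
    show "integrable M (\<lambda>\<omega>. exp (1 / 2 * \<bar>Y 0 \<omega>\<bar>))"
      unfolding Y_def by (rule log_sine_exp_abs) (auto intro: uniform)
    show "expectation (Y 0) = 0" "expectation (\<lambda>\<omega>. (Y 0 \<omega>)\<^sup>2) = pi\<^sup>2 / 12"
      unfolding Y_def by (rule log_sine_moments; auto intro: uniform)+
  qed auto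
  have prod_eq: "AE \<omega> in M. \<forall>N. sine_prod X N \<omega> = exp (Y.S N \<omega>)"
  proof -
    have "AE \<omega> in M. \<forall>i. sin (pi * X (Suc i) \<omega>) > 0"
      by (subst AE_all_countable) (auto intro!: sin_uniform_pos uniform)
    then show ?thesis
    proof eventually_elim
      case (elim \<omega>)
      then show ?case
        unfolding sine_prod_def Y.S_def by (simp add: Y_def exp_sum prod.atLeast1_atMost_eq)
    qed
  qed
  have sqrt_eq: "b * sqrt (2 * (pi\<^sup>2 / 12) * x) = b * (pi / sqrt 6) * sqrt x" for b x
  proof -
    have "2 * (pi\<^sup>2 / 12) * x = pi\<^sup>2 / 6 * x" by simp
    then show ?thesis by (simp add: real_sqrt_mult real_sqrt_divide)
  qed
  \<comment> \<open>Chosen so that \<open>c * (pi / sqrt 6)\<close> is exactly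
    \<open>pi / sqrt 6 + \<epsilon>\<close>. For \<eta> the same quantity is capped at 1/2, because
    \<open>lil_lower\<close> needs \<open>\<eta> < 1\<close> even when \<epsilon> is large.\<close>
  define c where "c = 1 + \<epsilon> * sqrt 6 / pi"
  define \<eta> where "\<eta> = min (1 / 2) (\<epsilon> * sqrt 6 / pi)"
  have c: "c > 1" "c * (pi / sqrt 6) = pi / sqrt 6 + \<epsilon>"
    using assms(4) by (auto simp: c_def field_simps)
  have \<eta>: "0 < \<eta>" "\<eta> < 1" using assms(4) by (auto simp: \<eta>_def)
  have "\<eta> * (pi / sqrt 6) \<le> (\<epsilon> * sqrt 6 / pi) * (pi / sqrt 6)"
    by (intro mult_right_mono) (auto simp: \<eta>_def)
  then have "\<eta> * (pi / sqrt 6) \<le> \<epsilon>" by simp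
  then have \<eta>_le: "pi / sqrt 6 - \<epsilon> \<le> (1 - \<eta>) * (pi / sqrt 6)"
    unfolding left_diff_distrib by linarith
  show ?thesis
    using prod_eq Y.lil_upper[OF c(1)] Y.lil_lower[OF \<eta>]
  proof eventually_elim
    case (elim \<omega>)
    have "\<forall>\<^sub>F N in sequentially. sine_prod X N \<omega>
        \<le> exp ((pi / sqrt 6 + \<epsilon>) * sqrt (real N * ln (ln (real N))))"
      using elim(2) by eventually_elim (simp only: elim(1) sqrt_eq exp_le_cancel_iff c(2))
    moreover have "\<exists>\<^sub>\<infinity>N. exp ((pi / sqrt 6 - \<epsilon>) * sqrt (real N * ln (ln (real N)))) \<le> sine_prod X N \<omega>"
      unfolding INFM_nat_le
    proof
      fix m
      \<comment> \<open>From 3 on, \<open>ln (ln (real n))\<close> is nonnegative. This matters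
        because \<open>sqrt\<close> of a negative number is negative, which would reverse the
        comparison of the coefficients.\<close>
      obtain n where n: "n \<ge> max m 3"
        "(1 - \<eta>) * sqrt (2 * (pi\<^sup>2 / 12) * (real n * ln (ln (real n)))) \<le> Y.S n \<omega>"
        using elim(3) unfolding INFM_nat_le by blast
      have "exp 1 \<le> real n" using n(1) exp_le by simp
      then have "ln (real n) \<ge> 1" by (subst ln_ge_iff) (use n(1) in auto)
      then have "sqrt (real n * ln (ln (real n))) \<ge> 0" by simp
      then have "(pi / sqrt 6 - \<epsilon>) * sqrt (real n * ln (ln (real n)))
          \<le> (1 - \<eta>) * (pi / sqrt 6) * sqrt (real n * ln (ln (real n)))"
        by (intro mult_right_mono \<eta>_le)
      also have "\<dots> \<le> Y.S n \<omega>" using n(2) by (simp only: sqrt_eq)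
      finally have "exp ((pi / sqrt 6 - \<epsilon>) * sqrt (real n * ln (ln (real n)))) \<le> sine_prod X n \<omega>"
        by (simp add: elim(1))
      then show "\<exists>n\<ge>m. exp ((pi / sqrt 6 - \<epsilon>) * sqrt (real n * ln (ln (real n)))) \<le> sine_prod X n \<omega>"
        using n(1) by (intro exI[of _ n]) simp
    qed
    ultimately show ?case by blast
  qed
qed

end
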